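(* Let $u:\mathbb R\to[0,\infty)$ be continuous with compact support and let $W=\sum_k\delta_{(x_k,y_k)}\in\mathcal T$. For every $x_k\in\mathcal J_W$ the function $t\mapsto u_W(t,x_k)$ is differentiable on $[0,\infty)$ (one-sided at $t=0$) and $$\frac{\partial}{\partial t}u_W(t,x_k)=-\lim_{h\to0^+}\frac{u_W(t,x_k)-u_W(t,x_k-h)}{\sigma_W((x_k-h,x_k])},\qquad\forall x_k\in\mathcal J_W,\ t\ge0.$$ Moreover, if $W\in\mathcal T'$ then also $$\frac{\partial}{\partial t}u_W(t,x_k)=-\lim_{h\to0^+}\frac{u_W(t,x_k+h)-u_W(t,x_k)}{\sigma_W((x_k,x_k+h])},\qquad\forall x_k\in\mathcal J_W,\ t>0.$$
   Context: $\mathcal T$ is the set of point processes $W=\sum_k\delta_{(x_k,y_k)}$ on $\mathbb R\times(0,\infty]$ (Radon point measures; sets $[-L,L]\times[\varepsilon,\infty]$ are compact) such that: (1) $W(\mathbb R\times\{\infty\})=0$; (2) $\sup_xW(\{x\}\times(0,\infty])=1$; (3) there is $\varepsilon_0>0$ with $W((-\infty,-L]\times[\varepsilon_0,\infty))=W([L,\infty)\times[\varepsilon_0,\infty))=\infty$ for all $L<\infty$; (4) $\iint_{[-L,L]\times(0,\varepsilon)}y\,W(dx\,dy)<\infty$ for all $\varepsilon>0$, $L<\infty$. $\mathcal J_W=\{x:W(\{x\}\times(0,\infty))>0\}$, and $\mathcal T'$ is the set of $W\in\mathcal T$ with $\mathcal J_W$ dense in $\mathbb R$. $\sigma_W(A)=\iint_{A\times(0,\infty)}y\,W(dx\,dy)$.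 Let $\{\zeta_k\}$ be i.i.d. Exp(1), $\tau_W=\sum_ky_k\zeta_k\delta_{x_k}$ (a.s. a Radon measure), $Z_W^*(t;x)=\inf\{x':\tau_W((x',x])\le t\}$, and $u_W(t,x)=\mathbf E[u(Z_W^*(t;x))]$ for $t\ge0$, $x\in\mathbb R$. *)

theory Defs
  imports "HOL-Probability.Probability"
begin

definition state_space :: "(real \<times> ennreal) measure" where
  "state_space = restrict_space borel (UNIV \<times> {0<..})"

text \<open>\<open>enumerates W K x y\<close> says that \<open>W\<close> is the sum over \<open>k \<in> K\<close> of the unit point masses at
  \<open>(x k, y k)\<close>. A Radon point measure on the state space has at most countably many atoms
  (each of finite multiplicity), so index sets \<open>K\<close> of natural numbers suffice.\<close>

definition enumerates ::
  "(real \<times> ennreal) measure \<Rightarrow> nat set \<Rightarrow> (nat \<Rightarrow> real) \<Rightarrow> (nat \<Rightarrow> ennreal) \<Rightarrow> bool" where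
  "enumerates W K x y \<longleftrightarrow>
     (\<forall>k\<in>K. 0 < y k) \<and> W = distr (count_space K) state_space (\<lambda>k. (x k, y k))"

definition radon_point_measure :: "(real \<times> ennreal) measure \<Rightarrow> bool" where
  "radon_point_measure W \<longleftrightarrow>
     (\<exists>K x y. enumerates W K x y) \<and>
     (\<forall>C. compact C \<and> C \<subseteq> UNIV \<times> {0<..} \<longrightarrow> emeasure W C < \<infinity>)"

definition \<T> :: "(real \<times> ennreal) measure set" where
  "\<T> = {W. radon_point_measure W \<and>
      emeasure W (UNIV \<times> {\<infinity>}) = 0 \<and>
      (SUP x. emeasure W ({x} \<times> {0<..})) = 1 \<and>
      (\<exists>\<epsilon>\<^sub>0::real. \<epsilon>\<^sub>0 > 0 \<and> (\<forall>L::real.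
         emeasure W ({..-L} \<times> {ennreal \<epsilon>\<^sub>0..<\<infinity>}) = \<infinity> \<and>
         emeasure W ({L..} \<times> {ennreal \<epsilon>\<^sub>0..<\<infinity>}) = \<infinity>)) \<and>
      (\<forall>(\<epsilon>::real) (L::real). \<epsilon> > 0 \<longrightarrow>
         (\<integral>\<^sup>+p\<in>({-L..L} \<times> {0<..<ennreal \<epsilon>}). snd p \<partial>W) < \<infinity>)}"

definition jump_set :: "(real \<times> ennreal) measure \<Rightarrow> real set" where
  "jump_set W = {x. emeasure W ({x} \<times> {0<..<\<infinity>}) > 0}"

definition \<T>' :: "(real \<times> ennreal) measure set" where
  "\<T>' = {W \<in> \<T>. closure (jump_set W) = UNIV}"

definition sigma_W :: "(real \<times> ennreal) measure \<Rightarrow> real set \<Rightarrow> ennreal" where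
  "sigma_W W A = (\<integral>\<^sup>+p\<in>(A \<times> {0<..<\<infinity>}). snd p \<partial>W)"

text \<open>The random measure placing mass \<open>y k * \<zeta> k \<omega>\<close> at \<open>x k\<close> for \<open>k \<in> K\<close>; the coercion
  \<open>ennreal\<close> only affects the null event that some \<open>\<zeta> k\<close> is negative.\<close>

definition tau_W ::
  "nat set \<Rightarrow> (nat \<Rightarrow> real) \<Rightarrow> (nat \<Rightarrow> ennreal) \<Rightarrow> (nat \<Rightarrow> 'a \<Rightarrow> real) \<Rightarrow> 'a \<Rightarrow> real measure" where
  "tau_W K x y \<zeta> \<omega> = distr (point_measure K (\<lambda>k. y k * ennreal (\<zeta> k \<omega>))) borel x"

text \<open>For \<open>W \<in> \<T>\<close> the set below is almost surely bounded from below; on the exceptional null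
  event it is all of \<open>\<real>\<close> and \<open>Inf\<close> is a fixed unspecified real.\<close>

definition Z_star ::
  "nat set \<Rightarrow> (nat \<Rightarrow> real) \<Rightarrow> (nat \<Rightarrow> ennreal) \<Rightarrow> (nat \<Rightarrow> 'a \<Rightarrow> real) \<Rightarrow> real \<Rightarrow> real \<Rightarrow> 'a \<Rightarrow> real" where
  "Z_star K x y \<zeta> t a \<omega> = Inf {x'. emeasure (tau_W K x y \<zeta> \<omega>) {x'<..a} \<le> ennreal t}"

definition u_W ::
  "'a measure \<Rightarrow> (nat \<Rightarrow> 'a \<Rightarrow> real) \<Rightarrow> nat set \<Rightarrow> (nat \<Rightarrow> real) \<Rightarrow> (nat \<Rightarrow> ennreal) \<Rightarrow>
   (real \<Rightarrow> real) \<Rightarrow> real \<Rightarrow> real \<Rightarrow> real" where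
  "u_W M \<zeta> K x y u t a = (\<integral>\<omega>. u (Z_star K x y \<zeta> t a \<omega>) \<partial>M)"

end

theory Submission
  imports Defs
begin

text \<open>Fix a jump point \<open>a = x\<^sub>i\<close> and let \<open>v t\<close> be the expectation of \<open>u\<close> at the position where the
  mass strictly to the left of \<open>a\<close> exceeds \<open>t\<close>. The atom at \<open>a\<close> is exponential with mean \<open>y\<^sub>i\<close> and
  independent of everything to its left, so \<open>u\<^sub>W(\<cdot>, a)\<close> solves the renewal equation whose differential
  form is \<open>y\<^sub>i \<partial>\<^sub>t u\<^sub>W = v - u\<^sub>W\<close>; here \<open>v\<close> is continuous because no deterministic level \<open>t > 0\<close> is
  attained by the mass of an interval with positive probability. As \<open>h \<rightarrow> 0\<close>, the process started at
  \<open>a - h\<close> converges to the one started just left of \<open>a\<close> and \<open>\<sigma>\<^sub>W((a - h, a]) \<rightarrow> y\<^sub>i\<close>, which is the left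
  quotient. On the right, \<open>S = \<tau>\<^sub>W((a, a + h])\<close> is independent of the configuration up to \<open>a\<close>, has mean
  \<open>\<sigma> = \<sigma>\<^sub>W((a, a + h])\<close> and satisfies \<open>E S\<^sup>2 \<le> 2 \<sigma>\<^sup>2\<close>; expanding \<open>u\<^sub>W(t - S, a)\<close> to first order gives
  \<open>u\<^sub>W(t, a + h) = u\<^sub>W(t, a) - \<sigma> \<partial>\<^sub>t u\<^sub>W(t, a) + o(\<sigma>)\<close>.\<close>

section \<open>Mass and hitting positions of a family of atoms\<close>

locale point_family =
  fixes K :: "nat set" and x :: "nat \<Rightarrow> real" and y :: "nat \<Rightarrow> ennreal"
begin

text \<open>\<open>\<xi>\<close> stands for one realisation of the exponential weights, so this
  section is deterministic. The underlying measure is \<open>tau_W\<close> before it is pushed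
  forward along \<open>x\<close>.\<close>

definition mass :: "(nat \<Rightarrow> real) \<Rightarrow> nat set \<Rightarrow> ennreal" where
  "mass \<xi> X = emeasure (point_measure K (\<lambda>k. y k * ennreal (\<xi> k))) X"

text \<open>Working with sets of indices instead of subsets of \<open>\<real>\<close>, the same definition covers both the
  process started at \<open>a\<close> (indices with \<open>x k \<le> a\<close>) and its left limit (indices with \<open>x k < a\<close>).\<close>

definition hit :: "(nat \<Rightarrow> real) \<Rightarrow> nat set \<Rightarrow> real \<Rightarrow> real" where
  "hit \<xi> J t = Inf {c. mass \<xi> {k\<in>J. c < x k} \<le> ennreal t}"

text \<open>Separating the fixed weights \<open>y\<close> (the measure) from the random factors (the
  integrand) gives the shape to which Cauchy-Schwarz is applied later.\<close>

lemma mass_nn_integral: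
  assumes "X \<subseteq> K"
  shows "mass \<xi> X = (\<integral>\<^sup>+k. ennreal (\<xi> k) * indicator X k \<partial>point_measure K y)"
proof -
  have "mass \<xi> X = (\<integral>\<^sup>+k. y k * ennreal (\<xi> k) * indicator X k \<partial>count_space K)"
    using assms by (simp add: mass_def point_measure_def emeasure_density)
  also have "\<dots> = (\<integral>\<^sup>+k. ennreal (\<xi> k) * indicator X k \<partial>point_measure K y)"
    by (simp add: point_measure_def nn_integral_density mult.assoc)
  finally show ?thesis .
qed

text \<open>A series over all naturals gives access to measurability of countable sums and to
  termwise expectation.\<close>

lemma mass_suminf:
  assumes "X \<subseteq> K"
  shows "mass \<xi> X = (\<Sum>k. y k * ennreal (\<xi> k) * indicator X k)"
proof -
  have "mass \<xi> X = (\<integral>\<^sup>+k. y k * ennreal (\<xi> k) * indicator X k \<partial>count_space K)"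
    using assms by (simp add: mass_def point_measure_def emeasure_density)
  also have "\<dots> = (\<integral>\<^sup>+k. y k * ennreal (\<xi> k) * indicator X k \<partial>count_space UNIV)"
    using assms by (intro nn_integral_count_space_eq) (auto simp: indicator_def)
  finally show ?thesis by (simp add: nn_integral_count_space_nat)
qed

lemma mass_singleton: "k \<in> K \<Longrightarrow> mass \<xi> {k} = y k * ennreal (\<xi> k)"
  unfolding mass_def
  by (subst emeasure_point_measure_finite2) auto

lemma mass_empty [simp]: "mass \<xi> {} = 0"
  by (simp add: mass_def)

lemma mass_cong:
  assumes "X \<subseteq> K" "\<And>k. k \<in> X \<Longrightarrow> \<xi> k = \<xi>' k"
  shows "mass \<xi> X = mass \<xi>' X"
proof -
  have "(\<lambda>k. y k * ennreal (\<xi> k) * indicator X k) = (\<lambda>k. y k * ennreal (\<xi>' k) * indicator X k)"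
    using assms by (auto simp: fun_eq_iff indicator_def)
  then show ?thesis
    using assms by (simp add: mass_suminf)
qed

lemma mass_mono: "X \<subseteq> Y \<Longrightarrow> Y \<subseteq> K \<Longrightarrow> mass \<xi> X \<le> mass \<xi> Y"
  unfolding mass_def by (intro emeasure_mono) (auto simp: sets_point_measure)

lemma mass_Un: "X \<subseteq> K \<Longrightarrow> Y \<subseteq> K \<Longrightarrow> X \<inter> Y = {} \<Longrightarrow> mass \<xi> (X \<union> Y) = mass \<xi> X + mass \<xi> Y"
  unfolding mass_def by (intro plus_emeasure[symmetric]) (auto simp: sets_point_measure)

lemma mass_tendsto_Union:
  assumes "incseq X" "(\<Union>n. X n) \<subseteq> K"
  shows "(\<lambda>n. mass \<xi> (X n)) \<longlonglongrightarrow> mass \<xi> (\<Union>n. X n)"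
  unfolding mass_def using assms by (intro Lim_emeasure_incseq) (auto simp: sets_point_measure)

section \<open>Hitting positions: shift, bounds and convergence\<close>

lemma hit_cong:
  assumes "J \<subseteq> K" "\<And>k. k \<in> J \<Longrightarrow> \<xi> k = \<xi>' k"
  shows "hit \<xi> J t = hit \<xi>' J t"
proof -
  have "mass \<xi> {k\<in>J. c < x k} = mass \<xi>' {k\<in>J. c < x k}" for c
    using assms by (intro mass_cong) auto
  then show ?thesis by (simp add: hit_def)
qed

lemma hit_restrict: "J \<subseteq> K \<Longrightarrow> hit (restrict \<xi> J) J t = hit \<xi> J t"
  by (rule hit_cong) auto

lemma mass_restrict: "J \<subseteq> K \<Longrightarrow> mass (restrict \<xi> J) J = mass \<xi> J"
  by (rule mass_cong) auto

text \<open>Pathwise renewal identity: coming from the right, the process crosses all of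
  \<open>C\<close> first, which uses up \<open>mass \<xi> C\<close> of the level and leaves the
  remainder for \<open>J\<close>.\<close>

lemma hit_shift:
  assumes "J \<subseteq> K" "C \<subseteq> K" and above: "\<And>j k. j \<in> J \<Longrightarrow> k \<in> C \<Longrightarrow> x j < x k"
    and le: "mass \<xi> C \<le> ennreal t" and t: "0 \<le> t"
  shows "hit \<xi> (J \<union> C) t = hit \<xi> J (t - enn2real (mass \<xi> C))"
proof -
  have dis: "J \<inter> C = {}" using above by force
  obtain m where m: "mass \<xi> C = ennreal m" "0 \<le> m" "m \<le> t"
    using le t by (cases "mass \<xi> C") (auto simp: top_unique)
  have "mass \<xi> {k\<in>J\<union>C. c < x k} \<le> ennreal t \<longleftrightarrow> mass \<xi> {k\<in>J. c < x k} \<le> ennreal (t - m)" for c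
  proof (cases "\<forall>k\<in>C. c < x k")
    case True
    then have "{k\<in>J\<union>C. c < x k} = {k\<in>J. c < x k} \<union> C" by auto
    also have "mass \<xi> \<dots> = mass \<xi> {k\<in>J. c < x k} + ennreal m"
      using assms(1,2) dis m by (subst mass_Un) auto
    finally show ?thesis
      using m t by (cases "mass \<xi> {k\<in>J. c < x k}") (auto simp: ennreal_plus[symmetric] top_unique simp del: ennreal_plus)
  next
    \<comment> \<open>Some atom of \<open>C\<close> lies at or below \<open>c\<close>, so no atom of
      \<open>J\<close> lies above \<open>c\<close>; both inequalities then hold.\<close>
    case False
    then have *: "{k\<in>J. c < x k} = {}" using above by force
    then have "mass \<xi> {k\<in>J\<union>C. c < x k} \<le> mass \<xi> C"
      using assms(2) by (intro mass_mono) auto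
    with le show ?thesis unfolding * by auto
  qed
  then show ?thesis
    using m by (simp add: hit_def)
qed

lemma hit_eq_top:
  assumes "J \<subseteq> K" "i \<in> J" "\<And>j. j \<in> J \<Longrightarrow> x j \<le> x i" "ennreal t < mass \<xi> {i}"
  shows "hit \<xi> J t = x i"
proof -
  have "mass \<xi> {k\<in>J. c < x k} \<le> ennreal t \<longleftrightarrow> x i \<le> c" for c
  proof (cases "x i \<le> c")
    case True
    then have *: "{k\<in>J. c < x k} = {}" using assms(3) by force
    show ?thesis unfolding * using True by simp
  next
    case False
    then have "mass \<xi> {i} \<le> mass \<xi> {k\<in>J. c < x k}"
      using assms(1,2) by (intro mass_mono) auto
    with assms(4) False show ?thesis by auto
  qed
  then have "{c. mass \<xi> {k\<in>J. c < x k} \<le> ennreal t} = {x i..}" by auto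
  then show ?thesis by (simp add: hit_def)
qed

text \<open>\<open>Inf\<close> on the reals exceeds a lower bound only for a nonempty set; the bound
  \<open>b\<close> on the atoms supplies a member, since no mass lies above it.\<close>

lemma le_hit:
  assumes "J \<subseteq> K" "\<And>k. k \<in> J \<Longrightarrow> x k \<le> b" "ennreal t < mass \<xi> {k\<in>J. c < x k}"
  shows "c \<le> hit \<xi> J t"
  unfolding hit_def
proof (rule cInf_greatest)
  have "{k\<in>J. b < x k} = {}" using assms(2) by force
  then have "b \<in> {c. mass \<xi> {k\<in>J. c < x k} \<le> ennreal t}" by (simp only: mem_Collect_eq mass_empty zero_le)
  then show "{c. mass \<xi> {k\<in>J. c < x k} \<le> ennreal t} \<noteq> {}" by blast
next
  fix d assume "d \<in> {c. mass \<xi> {k\<in>J. c < x k} \<le> ennreal t}"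
  then have d: "mass \<xi> {k\<in>J. d < x k} \<le> ennreal t" by simp
  show "c \<le> d"
  proof (rule ccontr)
    assume "\<not> c \<le> d"
    then have "mass \<xi> {k\<in>J. c < x k} \<le> mass \<xi> {k\<in>J. d < x k}"
      using assms(1) by (intro mass_mono) auto
    with d assms(3) show False by auto
  qed
qed

text \<open>The mass is infinite and every level is already exceeded to the right of some finite
  point. This bounds the set in \<open>hit\<close> from below, so that \<open>Inf\<close> is a true
  infimum.\<close>

definition escapes :: "(nat \<Rightarrow> real) \<Rightarrow> nat set \<Rightarrow> bool" where
  "escapes \<xi> J \<longleftrightarrow> (\<forall>t::real. \<exists>c. ennreal t < mass \<xi> {k\<in>J. c < x k})"

lemma hit_le:
  assumes "J \<subseteq> K" "escapes \<xi> J" "mass \<xi> {k\<in>J. c < x k} \<le> ennreal t"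
  shows "hit \<xi> J t \<le> c"
  unfolding hit_def
proof (rule cInf_lower)
  obtain b where b: "ennreal t < mass \<xi> {k\<in>J. b < x k}"
    using assms(2) unfolding escapes_def by blast
  show "bdd_below {c. mass \<xi> {k\<in>J. c < x k} \<le> ennreal t}"
  proof (rule bdd_belowI)
    fix d assume "d \<in> {c. mass \<xi> {k\<in>J. c < x k} \<le> ennreal t}"
    then have d: "mass \<xi> {k\<in>J. d < x k} \<le> ennreal t" by simp
    show "b \<le> d"
    proof (rule ccontr)
      assume "\<not> b \<le> d"
      then have "mass \<xi> {k\<in>J. b < x k} \<le> mass \<xi> {k\<in>J. d < x k}"
        using assms(1) by (intro mass_mono) auto
      with d b show False by auto
    qed
  qed
qed (use assms(3) in simp)

lemma less_hitD:
  assumes "J \<subseteq> K" "escapes \<xi> J" "c < hit \<xi> J t"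
  shows "ennreal t < mass \<xi> {k\<in>J. c < x k}"
  using hit_le[OF assms(1,2), of c t] assms(3) by (auto simp: not_le[symmetric])

lemma escapes_mono:
  assumes "escapes \<xi> I" "I \<subseteq> J" "J \<subseteq> K"
  shows "escapes \<xi> J"
  unfolding escapes_def
proof
  fix t :: real
  obtain c where "ennreal t < mass \<xi> {k\<in>I. c < x k}"
    using assms(1) unfolding escapes_def by blast
  also have "\<dots> \<le> mass \<xi> {k\<in>J. c < x k}"
    using assms by (intro mass_mono) auto
  finally show "\<exists>c. ennreal t < mass \<xi> {k\<in>J. c < x k}" by blast
qed

text \<open>Used for starting points increasing to a jump point. The lower bound is continuity of
  the mass from below; the upper bound is monotonicity, as more atoms stop the process
  earlier.\<close>

lemma hit_tendsto_Union:
  assumes J: "incseq J" "(\<Union>n. J n) \<subseteq> K" and b: "\<And>n k. k \<in> J n \<Longrightarrow> x k \<le> b"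
    and esc: "escapes \<xi> (J 0)"
  shows "(\<lambda>n. hit \<xi> (J n) t) \<longlonglongrightarrow> hit \<xi> (\<Union>n. J n) t"
proof (rule order_tendstoI)
  have escn: "escapes \<xi> (J n)" for n
    using esc by (rule escapes_mono) (use J incseqD[OF J(1), of 0 n] in auto)
  have escU: "escapes \<xi> (\<Union>n. J n)"
    using esc by (rule escapes_mono) (use J in auto)
  fix l
  { assume "l < hit \<xi> (\<Union>n. J n) t"
    \<comment> \<open>At a point strictly between, the union has mass strictly above t, and a strict
      inequality survives for large n.\<close>
    then obtain c where c: "l < c" "c < hit \<xi> (\<Union>n. J n) t" using dense by blast
    have "ennreal t < mass \<xi> {k\<in>(\<Union>n. J n). c < x k}"
      using J c escU by (intro less_hitD) auto
    moreover have "{k\<in>(\<Union>n. J n). c < x k} = (\<Union>n. {k\<in>J n. c < x k})" by auto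
    moreover have "(\<lambda>n. mass \<xi> {k\<in>J n. c < x k}) \<longlonglongrightarrow> mass \<xi> (\<Union>n. {k\<in>J n. c < x k})"
      using J by (intro mass_tendsto_Union) (auto simp: incseq_def)
    ultimately have "eventually (\<lambda>n. ennreal t < mass \<xi> {k\<in>J n. c < x k}) sequentially"
      by (auto intro: order_tendstoD)
    then show "eventually (\<lambda>n. l < hit \<xi> (J n) t) sequentially"
    proof eventually_elim
      case (elim n)
      then have "c \<le> hit \<xi> (J n) t" using J b by (intro le_hit[of _ b]) auto
      with c show ?case by simp
    qed }
  assume l: "hit \<xi> (\<Union>n. J n) t < l"
  have "hit \<xi> (J n) t \<le> hit \<xi> (\<Union>n. J n) t" for n
  proof (rule ccontr)
    assume "\<not> ?thesis"
    then obtain c where c: "hit \<xi> (\<Union>n. J n) t < c" "c < hit \<xi> (J n) t"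
      using dense by (auto simp only: not_le)
    have "ennreal t < mass \<xi> {k\<in>J n. c < x k}"
      using J c escn by (intro less_hitD) auto
    also have "\<dots> \<le> mass \<xi> {k\<in>(\<Union>n. J n). c < x k}"
      using J by (intro mass_mono) auto
    finally have "c \<le> hit \<xi> (\<Union>n. J n) t"
      using J b by (intro le_hit[of _ b]) auto
    with c show False by simp
  qed
  then have "hit \<xi> (J n) t < l" for n
    using l by (rule le_less_trans)
  then show "eventually (\<lambda>n. hit \<xi> (J n) t < l) sequentially"
    by simp
qed

text \<open>Right continuity in \<open>t\<close> is automatic; left continuity at \<open>t > 0\<close> can only fail at a level
  \<open>t\<close> that the mass attains on an interval, hence at a rational point.\<close>

lemma hit_tendsto_time:
  assumes J: "J \<subseteq> K" and b: "\<And>k. k \<in> J \<Longrightarrow> x k \<le> b" and esc: "escapes \<xi> J"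
    and s: "s \<longlonglongrightarrow> t" "\<And>n. 0 \<le> s n" "0 \<le> t"
    and levels: "\<And>q. q \<in> \<rat> \<Longrightarrow> t > 0 \<Longrightarrow> mass \<xi> {k\<in>J. q < x k} \<noteq> ennreal t"
  shows "(\<lambda>n. hit \<xi> J (s n)) \<longlonglongrightarrow> hit \<xi> J t"
proof (rule order_tendstoI)
  have s': "(\<lambda>n. ennreal (s n)) \<longlonglongrightarrow> ennreal t"
    using s by (intro tendsto_ennrealI)
  fix l
  { assume "l < hit \<xi> J t"
    then obtain c where c: "l < c" "c < hit \<xi> J t" using dense by blast
    then have "ennreal t < mass \<xi> {k\<in>J. c < x k}"
      using J esc by (intro less_hitD) auto
    with s' have "eventually (\<lambda>n. ennreal (s n) < mass \<xi> {k\<in>J. c < x k}) sequentially"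
      by (auto intro: order_tendstoD)
    then show "eventually (\<lambda>n. l < hit \<xi> J (s n)) sequentially"
    proof eventually_elim
      case (elim n)
      then have "c \<le> hit \<xi> J (s n)" using J b by (intro le_hit[of _ b]) auto
      with c show ?case by simp
    qed }
  assume "hit \<xi> J t < l"
  then obtain q where q: "q \<in> \<rat>" "hit \<xi> J t < q" "q < l" using Rats_dense_in_real by blast
  have le: "mass \<xi> {k\<in>J. q < x k} \<le> ennreal t"
    using le_hit[OF J b, of t \<xi> q] q by (auto simp: not_le[symmetric])
  have "eventually (\<lambda>n. mass \<xi> {k\<in>J. q < x k} \<le> ennreal (s n)) sequentially"
  proof (cases "t > 0")
    case True
    then have "mass \<xi> {k\<in>J. q < x k} < ennreal t" using le levels[OF q(1)] by auto
    then have "eventually (\<lambda>n. mass \<xi> {k\<in>J. q < x k} < ennreal (s n)) sequentially"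
      using s' by (auto intro: order_tendstoD)
    then show ?thesis by eventually_elim auto
  next
    \<comment> \<open>Now t = 0, so the mass above \<open>q\<close> is zero.\<close>
    case False
    then show ?thesis using le s(3) by auto
  qed
  then show "eventually (\<lambda>n. hit \<xi> J (s n) < l) sequentially"
  proof eventually_elim
    case (elim n)
    then have "hit \<xi> J (s n) \<le> q" using J esc by (intro hit_le) auto
    with q show ?case by simp
  qed
qed

section \<open>Measurability in the level and the weights\<close>

lemma mass_measurable:
  assumes "X \<subseteq> J" "J \<subseteq> K"
  shows "(\<lambda>\<xi>. mass \<xi> X) \<in> borel_measurable (PiM J (\<lambda>_. borel))"
proof -
  have "(\<lambda>\<xi>. \<Sum>k. y k * ennreal (\<xi> k) * indicator X k) \<in> borel_measurable (PiM J (\<lambda>_. borel))"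
  proof (rule borel_measurable_suminf_order)
    fix k
    show "(\<lambda>\<xi>. y k * ennreal (\<xi> k) * indicator X k) \<in> borel_measurable (PiM J (\<lambda>_. borel))"
    proof (cases "k \<in> X")
      case True
      then have "k \<in> J" using assms by auto
      then have [measurable]: "(\<lambda>\<xi>. \<xi> k) \<in> borel_measurable (PiM J (\<lambda>_. borel :: real measure))"
        by measurable
      show ?thesis by measurable
    qed simp
  qed
  then show ?thesis
    using assms by (subst mass_suminf) auto
qed

text \<open>Joint measurability is required because the level is later replaced by the random
  remainder left after crossing \<open>C\<close>. Monotonicity in the point reduces the event to
  countably many rational points.\<close>

lemma hit_measurable:
  assumes J: "J \<subseteq> K" and b: "\<And>k. k \<in> J \<Longrightarrow> x k \<le> b"
  shows "(\<lambda>(t, \<xi>). hit \<xi> J t) \<in> borel_measurable (borel \<Otimes>\<^sub>M PiM J (\<lambda>_. borel))"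
proof (rule borel_measurableI_less)
  have [measurable]: "(\<lambda>\<xi>. mass \<xi> {k\<in>J. c < x k}) \<in> borel_measurable (PiM J (\<lambda>_. borel))" for c
    using J by (intro mass_measurable) auto
  have anti: "mass \<xi> {k\<in>J. d < x k} \<le> mass \<xi> {k\<in>J. c < x k}" if "c \<le> d" for \<xi> c d
    using J that by (intro mass_mono) auto
  fix l :: real
  \<comment> \<open>on \<open>bad\<close> the set defining \<open>hit\<close> is all of \<open>\<real>\<close>, and \<open>Inf\<close> is an unspecified constant\<close>
  define bad where "bad t \<xi> \<longleftrightarrow> (\<forall>n::nat. mass \<xi> {k\<in>J. - real n < x k} \<le> ennreal t)" for t \<xi>
  have "hit \<xi> J t < l \<longleftrightarrow> (if bad t \<xi> then Inf (UNIV :: real set) < l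
      else \<exists>q\<in>\<rat>. q < l \<and> mass \<xi> {k\<in>J. q < x k} \<le> ennreal t)" for t \<xi>
  proof (cases "bad t \<xi>")
    case True
    have "mass \<xi> {k\<in>J. c < x k} \<le> ennreal t" for c
    proof -
      obtain n :: nat where "- c \<le> real n" using real_arch_simple by blast
      with anti[of "- real n" c \<xi>] True show ?thesis
        unfolding bad_def by (meson minus_le_iff order_trans)
    qed
    then have "hit \<xi> J t = Inf UNIV" by (simp add: hit_def)
    with True show ?thesis by simp
  next
    case False
    then obtain n :: nat where n: "ennreal t < mass \<xi> {k\<in>J. - real n < x k}"
      by (auto simp: bad_def not_le)
    have "mass \<xi> {k\<in>J. b < x k} \<le> ennreal t"
    proof -
      have *: "{k\<in>J. b < x k} = {}" using b by force
      show ?thesis unfolding * by simp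
    qed
    then have ne: "{c. mass \<xi> {k\<in>J. c < x k} \<le> ennreal t} \<noteq> {}" by blast
    have bdd: "bdd_below {c. mass \<xi> {k\<in>J. c < x k} \<le> ennreal t}"
    proof (rule bdd_belowI)
      fix d assume "d \<in> {c. mass \<xi> {k\<in>J. c < x k} \<le> ennreal t}"
      with n anti[of d "- real n" \<xi>] show "- real n \<le> d" by (force simp: not_le[symmetric])
    qed
    have "hit \<xi> J t < l \<longleftrightarrow> (\<exists>c<l. mass \<xi> {k\<in>J. c < x k} \<le> ennreal t)"
      unfolding hit_def using cInf_less_iff[OF ne bdd] by auto
    also have "\<dots> \<longleftrightarrow> (\<exists>q\<in>\<rat>. q < l \<and> mass \<xi> {k\<in>J. q < x k} \<le> ennreal t)"
    proof safe
      fix c assume c: "c < l" "mass \<xi> {k\<in>J. c < x k} \<le> ennreal t"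
      then obtain q where "q \<in> \<rat>" "c < q" "q < l" using Rats_dense_in_real by blast
      with c anti[of c q \<xi>] show "\<exists>q\<in>\<rat>. q < l \<and> mass \<xi> {k\<in>J. q < x k} \<le> ennreal t"
        by (intro bexI[of _ q]) auto
    qed auto
    finally show ?thesis using False by simp
  qed
  then have "{p \<in> space (borel \<Otimes>\<^sub>M PiM J (\<lambda>_. borel)). (case p of (t, \<xi>) \<Rightarrow> hit \<xi> J t) < l} =
     {p \<in> space (borel \<Otimes>\<^sub>M PiM J (\<lambda>_. borel)). if bad (fst p) (snd p) then Inf (UNIV :: real set) < l
      else \<exists>q\<in>\<rat>. q < l \<and> mass (snd p) {k\<in>J. q < x k} \<le> ennreal (fst p)}"
    by (auto simp: case_prod_beta)
  also have "\<dots> \<in> sets (borel \<Otimes>\<^sub>M PiM J (\<lambda>_. borel))"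
    unfolding bad_def by (measurable; simp add: countable_rat)
  finally show "{p \<in> space (borel \<Otimes>\<^sub>M PiM J (\<lambda>_. borel)). (case p of (t, \<xi>) \<Rightarrow> hit \<xi> J t) < l}
      \<in> sets (borel \<Otimes>\<^sub>M PiM J (\<lambda>_. borel))" .
qed

end

section \<open>Independent exponential weights\<close>

text \<open>The joint law is the product of the laws, so Fubini applies; both integrals are then
  pulled back to \<open>M\<close>, where \<omega>' plays the role of an independent copy.\<close>

lemma (in prob_space) indep_var_integral_iterated:
  fixes f :: "'b \<times> 'b \<Rightarrow> real"
  assumes ind: "indep_var S X T Y"
    and f [measurable]: "f \<in> borel_measurable (S \<Otimes>\<^sub>M T)" and bnd: "\<And>p. \<bar>f p\<bar> \<le> B"
  shows "(\<integral>\<omega>. f (X \<omega>, Y \<omega>) \<partial>M) = (\<integral>\<omega>. (\<integral>\<omega>'. f (X \<omega>, Y \<omega>') \<partial>M) \<partial>M)"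
proof -
  have X [measurable]: "X \<in> measurable M S" and Y [measurable]: "Y \<in> measurable M T"
    and eq: "distr M S X \<Otimes>\<^sub>M distr M T Y = distr M (S \<Otimes>\<^sub>M T) (\<lambda>x. (X x, Y x))"
    using ind unfolding indep_var_distribution_eq by auto
  interpret X: prob_space "distr M S X" by (rule prob_space_distr) fact
  interpret Y: prob_space "distr M T Y" by (rule prob_space_distr) fact
  interpret XY: pair_prob_space "distr M S X" "distr M T Y" ..
  have f' [measurable]: "f \<in> borel_measurable (distr M S X \<Otimes>\<^sub>M distr M T Y)"
    using f by (simp cong: measurable_cong_sets)
  have int: "integrable (distr M S X \<Otimes>\<^sub>M distr M T Y) f"
    using bnd by (intro XY.integrable_const_bound[of _ B]) auto
  have "(\<integral>\<omega>. f (X \<omega>, Y \<omega>) \<partial>M) = integral\<^sup>L (distr M (S \<Otimes>\<^sub>M T) (\<lambda>x. (X x, Y x))) f"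
    by (subst integral_distr) auto
  also have "\<dots> = integral\<^sup>L (distr M S X \<Otimes>\<^sub>M distr M T Y) f"
    by (simp add: eq)
  also have "\<dots> = (\<integral>a. (\<integral>b. f (a, b) \<partial>distr M T Y) \<partial>distr M S X)"
    using XY.integral_fst'[OF int] by simp
  also have "\<dots> = (\<integral>\<omega>. (\<integral>b. f (X \<omega>, b) \<partial>distr M T Y) \<partial>M)"
    by (subst integral_distr) (auto intro!: Y.borel_measurable_lebesgue_integral)
  also have "\<dots> = (\<integral>\<omega>. (\<integral>\<omega>'. f (X \<omega>, Y \<omega>') \<partial>M) \<partial>M)"
  proof (rule Bochner_Integration.integral_cong[OF refl])
    fix \<omega> assume "\<omega> \<in> space M"
    then have "X \<omega> \<in> space S" by (rule measurable_space[OF X])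
    then have [measurable]: "(\<lambda>b. f (X \<omega>, b)) \<in> borel_measurable T" by measurable
    show "(\<integral>b. f (X \<omega>, b) \<partial>distr M T Y) = (\<integral>\<omega>'. f (X \<omega>, Y \<omega>') \<partial>M)"
      by (subst integral_distr) auto
  qed
  finally show ?thesis .
qed

text \<open>Collects what membership in \<open>\<T>\<close> yields for an enumeration, so that the
  probabilistic argument can be run on indices alone. The uniform lower bound in
  \<open>left_infinite\<close> is what makes the random mass diverge to the left.\<close>

locale exp_family = point_family K x y + prob_space M
  for K x y and M :: "'a measure" +
  fixes \<zeta> :: "nat \<Rightarrow> 'a \<Rightarrow> real"
  assumes inj_x: "inj_on x K"
    and y_pos: "\<And>k. k \<in> K \<Longrightarrow> 0 < y k"
    and y_fin: "\<And>k. k \<in> K \<Longrightarrow> y k < \<infinity>"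
    and locally_finite: "\<And>p q. emeasure (point_measure K y) {k\<in>K. p < x k \<and> x k \<le> q} < \<infinity>"
    and left_infinite: "\<exists>\<epsilon>>0. \<forall>b. infinite {k\<in>K. x k \<le> b \<and> ennreal \<epsilon> \<le> y k}"
    and indep: "indep_vars (\<lambda>_. borel) \<zeta> K"
    and expo: "\<And>k. k \<in> K \<Longrightarrow> distributed M lborel (\<zeta> k) (exponential_density 1)"
begin

abbreviation wt :: "nat set \<Rightarrow> ennreal" where
  "wt \<equiv> emeasure (point_measure K y)"

abbreviation Z :: "'a \<Rightarrow> nat \<Rightarrow> real" where
  "Z \<omega> \<equiv> (\<lambda>k. \<zeta> k \<omega>)"

lemma zeta_measurable: "k \<in> K \<Longrightarrow> \<zeta> k \<in> borel_measurable M"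
  using distributed_measurable[OF expo] by simp

lemma restrict_measurable:
  "J \<subseteq> K \<Longrightarrow> (\<lambda>\<omega>. restrict (Z \<omega>) J) \<in> measurable M (PiM J (\<lambda>_. borel))"
  by (intro measurable_restrict) (auto intro: zeta_measurable)

section \<open>Moments of the random mass\<close>

lemma mass_rv: "X \<subseteq> K \<Longrightarrow> (\<lambda>\<omega>. mass (Z \<omega>) X) \<in> borel_measurable M"
  using measurable_compose[OF restrict_measurable mass_measurable, of X X] by (simp add: mass_restrict)

text \<open>A general family \<eta> serves both for the weights themselves (\<open>c\<close> = 1)
  and for their squares (\<open>c\<close> = 2).\<close>

lemma nn_integral_mass:
  assumes X: "X \<subseteq> K" and [measurable]: "\<And>k. k \<in> X \<Longrightarrow> \<eta> k \<in> borel_measurable M"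
    and c: "\<And>k. k \<in> X \<Longrightarrow> (\<integral>\<^sup>+\<omega>. ennreal (\<eta> k \<omega>) \<partial>M) = c"
  shows "(\<integral>\<^sup>+\<omega>. mass (\<lambda>k. \<eta> k \<omega>) X \<partial>M) = c * wt X"
proof -
  have "(\<integral>\<^sup>+\<omega>. mass (\<lambda>k. \<eta> k \<omega>) X \<partial>M) = (\<integral>\<^sup>+\<omega>. (\<Sum>k. y k * ennreal (\<eta> k \<omega>) * indicator X k) \<partial>M)"
    using X by (simp add: mass_suminf)
  also have "\<dots> = (\<Sum>k. \<integral>\<^sup>+\<omega>. y k * ennreal (\<eta> k \<omega>) * indicator X k \<partial>M)"
  proof (rule nn_integral_suminf)
    fix k show "(\<lambda>\<omega>. y k * ennreal (\<eta> k \<omega>) * indicator X k) \<in> borel_measurable M"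
      by (cases "k \<in> X") auto
  qed
  \<comment> \<open>The factor \<open>ennreal 1\<close> makes the series an instance of
    \<open>mass_suminf\<close> with constant weights, whose mass is \<open>wt X\<close>.\<close>
  also have "\<dots> = (\<Sum>k. c * (y k * ennreal 1 * indicator X k))"
  proof (rule suminf_cong)
    fix k show "(\<integral>\<^sup>+\<omega>. y k * ennreal (\<eta> k \<omega>) * indicator X k \<partial>M) = c * (y k * ennreal 1 * indicator X k)"
      using c by (cases "k \<in> X") (auto simp: nn_integral_cmult mult.commute)
  qed
  also have "\<dots> = c * mass (\<lambda>_. 1) X"
    using X by (simp add: ennreal_suminf_cmult mass_suminf)
  finally show ?thesis by (simp add: mass_def)
qed

lemma nn_integral_zeta_power:
  assumes "k \<in> K"
  shows "(\<integral>\<^sup>+\<omega>. ennreal (\<zeta> k \<omega> ^ n) \<partial>M) = fact n"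
proof -
  \<comment> \<open>The exponential law is the Erlang law with shape parameter 0, whose moments are
    available.\<close>
  have D: "distributed M lborel (\<zeta> k) (erlang_density 0 1)"
    using expo[OF assms] by (simp add: exponential_density_def[abs_def] erlang_density_def[abs_def])
  note has_bochner_integral_erlang_ith_moment[of 1 "\<zeta> k" 0 n, OF _ D]
  moreover have "AE \<omega> in M. 0 \<le> \<zeta> k \<omega> ^ n"
    by (subst distributed_AE2[OF D]) (auto simp: erlang_density_def)
  ultimately show ?thesis
    by (subst nn_integral_eq_integral)
      (auto simp: has_bochner_integral_iff ennreal_fact)
qed

lemma nn_integral_mass_zeta: "X \<subseteq> K \<Longrightarrow> (\<integral>\<^sup>+\<omega>. mass (Z \<omega>) X \<partial>M) = wt X"
  using nn_integral_mass[of X \<zeta> 1] nn_integral_zeta_power[of _ 1] zeta_measurable by force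

text \<open>Cauchy-Schwarz with respect to the weights \<open>y\<close> bounds the squared mass by
  the mass with squared factors times \<open>wt X\<close>; the constant 2 is the second moment of
  Exp(1).\<close>

lemma nn_integral_mass_zeta_square:
  assumes X: "X \<subseteq> K"
  shows "(\<integral>\<^sup>+\<omega>. (mass (Z \<omega>) X)\<^sup>2 \<partial>M) \<le> 2 * (wt X)\<^sup>2"
proof -
  have CS: "(mass (Z \<omega>) X)\<^sup>2 \<le> mass (\<lambda>k. (\<zeta> k \<omega>)\<^sup>2) X * wt X" for \<omega>
  proof -
    let ?N = "point_measure K y"
    have "(mass (Z \<omega>) X)\<^sup>2 = (\<integral>\<^sup>+k. (ennreal (\<zeta> k \<omega>) * indicator X k) * indicator X k \<partial>?N)\<^sup>2"
      using X by (simp add: mass_nn_integral mult.assoc flip: indicator_inter_arith)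
    also have "\<dots> \<le> (\<integral>\<^sup>+k. (ennreal (\<zeta> k \<omega>) * indicator X k)\<^sup>2 \<partial>?N) * (\<integral>\<^sup>+k. (indicator X k)\<^sup>2 \<partial>?N)"
      by (intro Cauchy_Schwarz_nn_integral) (auto simp: measurable_point_measure_eq1)
    also have "(\<integral>\<^sup>+k. (indicator X k)\<^sup>2 \<partial>?N) = (\<integral>\<^sup>+k. indicator X k \<partial>?N)"
      by (intro nn_integral_cong) (auto simp: indicator_def)
    also have "\<dots> = wt X"
      using X by (simp add: sets_point_measure)
    also have "(\<integral>\<^sup>+k. (ennreal (\<zeta> k \<omega>) * indicator X k)\<^sup>2 \<partial>?N) \<le> (\<integral>\<^sup>+k. ennreal ((\<zeta> k \<omega>)\<^sup>2) * indicator X k \<partial>?N)"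
    proof (intro nn_integral_mono)
      fix k
      \<comment> \<open>Only an inequality: \<open>ennreal\<close> sends negative values to zero,
        while squaring keeps them.\<close>
      have "(ennreal (\<zeta> k \<omega>))\<^sup>2 \<le> ennreal ((\<zeta> k \<omega>)\<^sup>2)"
        by (cases "0 \<le> \<zeta> k \<omega>") (auto simp: ennreal_power ennreal_neg)
      then show "(ennreal (\<zeta> k \<omega>) * indicator X k)\<^sup>2 \<le> ennreal ((\<zeta> k \<omega>)\<^sup>2) * indicator X k"
        by (auto simp: indicator_def)
    qed
    also have "\<dots> = mass (\<lambda>k. (\<zeta> k \<omega>)\<^sup>2) X"
      using X by (simp add: mass_nn_integral)
    finally show ?thesis by (simp add: mult_right_mono)
  qed
  have [measurable]: "(\<lambda>\<omega>. mass (\<lambda>k. (\<zeta> k \<omega>)\<^sup>2) X) \<in> borel_measurable M"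
    unfolding mass_suminf[OF X]
  proof (rule borel_measurable_suminf_order)
    fix k show "(\<lambda>\<omega>. y k * ennreal ((\<zeta> k \<omega>)\<^sup>2) * indicator X k) \<in> borel_measurable M"
      using zeta_measurable[of k] X by (cases "k \<in> X") auto
  qed
  have "(\<integral>\<^sup>+\<omega>. (mass (Z \<omega>) X)\<^sup>2 \<partial>M) \<le> (\<integral>\<^sup>+\<omega>. mass (\<lambda>k. (\<zeta> k \<omega>)\<^sup>2) X * wt X \<partial>M)"
    by (intro nn_integral_mono CS)
  also have "\<dots> = (\<integral>\<^sup>+\<omega>. mass (\<lambda>k. (\<zeta> k \<omega>)\<^sup>2) X \<partial>M) * wt X"
    by (intro nn_integral_multc) measurable
  also have "(\<integral>\<^sup>+\<omega>. mass (\<lambda>k. (\<zeta> k \<omega>)\<^sup>2) X \<partial>M) = 2 * wt X"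
    using X zeta_measurable nn_integral_zeta_power[of _ 2]
    by (intro nn_integral_mass) (auto simp: fact_2 subset_iff)
  finally show ?thesis by (simp add: power2_eq_square mult.assoc)
qed

lemma AE_mass_finite:
  assumes "X \<subseteq> K" "wt X < \<infinity>"
  shows "AE \<omega> in M. mass (Z \<omega>) X < \<infinity>"
  using nn_integral_PInf_AE[OF mass_rv[OF assms(1)]] nn_integral_mass_zeta[OF assms(1)] assms(2)
  by (auto simp: less_top[symmetric])

text \<open>Weights over disjoint index sets are independent. \<open>C\<close> enters through its
  mass only, while \<open>J\<close> enters through all its coordinates, as \<open>hit\<close>
  requires.\<close>

lemma integral_mass_restrict_iterated:
  fixes g :: "ennreal \<times> (nat \<Rightarrow> real) \<Rightarrow> real"
  assumes JC: "J \<subseteq> K" "C \<subseteq> K" "J \<inter> C = {}"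
    and g: "g \<in> borel_measurable (borel \<Otimes>\<^sub>M PiM J (\<lambda>_. borel))" and bnd: "\<And>p. \<bar>g p\<bar> \<le> B"
  shows "(\<integral>\<omega>. g (mass (Z \<omega>) C, restrict (Z \<omega>) J) \<partial>M) =
    (\<integral>\<omega>. (\<integral>\<omega>'. g (mass (Z \<omega>) C, restrict (Z \<omega>') J) \<partial>M) \<partial>M)"
proof -
  have [measurable]: "(\<lambda>\<xi>. mass \<xi> C) \<in> borel_measurable (PiM C (\<lambda>_. borel))"
    using JC by (intro mass_measurable) auto
  have "(\<lambda>p. g (mass (fst p) C, snd p)) \<in> borel_measurable (PiM C (\<lambda>_. borel) \<Otimes>\<^sub>M PiM J (\<lambda>_. borel))"
    by (rule measurable_compose[OF _ g]) measurable
  moreover have "C \<inter> J = {}" using JC by auto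
  ultimately show ?thesis
    using indep_var_integral_iterated[OF indep_var_restrict[OF indep, of C J], of "\<lambda>p. g (mass (fst p) C, snd p)" B] JC bnd
    by (simp add: mass_restrict)
qed

section \<open>Almost sure properties of the random mass\<close>

lemma AE_zeta_neq:
  assumes "k \<in> K"
  shows "AE \<omega> in M. \<zeta> k \<omega> \<noteq> c"
proof -
  have "AE z in lborel. 0 < ennreal (exponential_density 1 z) \<longrightarrow> z \<noteq> c"
    using AE_lborel_singleton[of c] by eventually_elim simp
  then show ?thesis
    by (subst distributed_AE2[OF expo[OF assms]]) auto
qed

lemma AE_zeta_pos:
  assumes "k \<in> K"
  shows "AE \<omega> in M. 0 < \<zeta> k \<omega>"
proof -
  have "AE z in lborel. 0 < ennreal (exponential_density 1 z) \<longrightarrow> 0 < z"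
    using AE_lborel_singleton[of 0] by eventually_elim (auto simp: exponential_density_def)
  then show ?thesis
    by (subst distributed_AE2[OF expo[OF assms]]) auto
qed

text \<open>One atom \<open>j\<close> of \<open>X\<close> has a continuous law and is independent of
  the others. Given the mass r of the others, at most one value of its weight brings the total to t.
  Positivity of t settles the case of empty \<open>X\<close>, whose mass is 0.\<close>

lemma AE_mass_neq:
  assumes X: "X \<subseteq> K" and t: "0 < t"
  shows "AE \<omega> in M. mass (Z \<omega>) X \<noteq> ennreal t"
proof (cases "X = {}")
  case True
  then show ?thesis using t by simp
next
  case False
  then obtain j where j: "j \<in> X" "j \<in> K" using X by blast
  obtain m where m: "y j = ennreal m" "0 < m"
    using y_pos[OF j(2)] y_fin[OF j(2)] by (cases "y j") auto
  have split: "mass (Z \<omega>) X = mass (Z \<omega>) (X - {j}) + y j * ennreal (\<zeta> j \<omega>)" for \<omega>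
    using mass_Un[OF order.trans[OF Diff_subset X], of "{j}" "{j}" "Z \<omega>"] j
    by (simp add: mass_singleton insert_absorb)
  \<comment> \<open>Indicator of the exceptional event, as a function of the remaining mass and the
    coordinate \<open>j\<close>; its expectation is shown to vanish.\<close>
  define f :: "ennreal \<times> (nat \<Rightarrow> real) \<Rightarrow> real" where
    "f = (\<lambda>p. indicator {p. fst p + y j * ennreal (snd p j) = ennreal t} p)"
  have [measurable]: "f \<in> borel_measurable (borel \<Otimes>\<^sub>M PiM {j} (\<lambda>_. borel))"
    unfolding f_def by measurable
  have "(\<integral>\<omega>. f (mass (Z \<omega>) (X - {j}), restrict (Z \<omega>) {j}) \<partial>M) =
      (\<integral>\<omega>. (\<integral>\<omega>'. f (mass (Z \<omega>) (X - {j}), restrict (Z \<omega>') {j}) \<partial>M) \<partial>M)"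
    using X j by (intro integral_mass_restrict_iterated[where B=1])
      (auto simp: f_def indicator_def)
  also have "\<dots> = (\<integral>\<omega>. 0 \<partial>M)"
  proof (rule Bochner_Integration.integral_cong[OF refl])
    fix \<omega>
    let ?r = "mass (Z \<omega>) (X - {j})"
    have "AE \<omega>' in M. f (?r, restrict (Z \<omega>') {j}) = 0"
    proof (cases "?r \<le> ennreal t")
      case True
      then obtain r where r: "?r = ennreal r" "0 \<le> r" by (cases ?r) (auto simp: top_unique)
      show ?thesis
        \<comment> \<open>The quotient is the only nonnegative value of the weight that completes r
          to t.\<close>
        using AE_zeta_pos[OF j(2)] AE_zeta_neq[OF j(2), of "(t - r) / m"]
      proof eventually_elim
        case (elim \<omega>')
        then show ?case
          using r m t by (auto simp: f_def ennreal_mult[symmetric] ennreal_plus[symmetric] field_simps simp del: ennreal_plus)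
      qed
    next
      case False
      then have "?r + z \<noteq> ennreal t" for z
        by (metis add.right_neutral add_left_mono zero_le)
      then show ?thesis by (auto simp: f_def)
    qed
    then show "(\<integral>\<omega>'. f (?r, restrict (Z \<omega>') {j}) \<partial>M) = 0"
      by (subst integral_cong_AE[where g="\<lambda>_. 0"])
         (use measurable_compose[OF restrict_measurable[of "{j}"]] j in \<open>auto intro!: measurable_compose[OF _ \<open>f \<in> borel_measurable _\<close>] measurable_Pair restrict_measurable simp del: restrict_apply\<close>)
  qed
  finally have 0: "(\<integral>\<omega>. f (mass (Z \<omega>) (X - {j}), restrict (Z \<omega>) {j}) \<partial>M) = 0" by simp
  have "(\<lambda>\<omega>. f (mass (Z \<omega>) (X - {j}), restrict (Z \<omega>) {j})) \<in> borel_measurable M"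
    using X j by (intro measurable_compose[OF _ \<open>f \<in> borel_measurable _\<close>] measurable_Pair mass_rv restrict_measurable) auto
  then have "integrable M (\<lambda>\<omega>. f (mass (Z \<omega>) (X - {j}), restrict (Z \<omega>) {j}))"
    by (rule integrable_const_bound[of _ 1, rotated]) (simp add: f_def indicator_def)
  then have "AE \<omega> in M. f (mass (Z \<omega>) (X - {j}), restrict (Z \<omega>) {j}) = 0"
    using 0 by (subst (asm) integral_nonneg_eq_0_iff_AE) (auto simp: f_def)
  then show ?thesis
    by eventually_elim (auto simp: f_def split indicator_def split: if_splits)
qed

text \<open>A hands-on second Borel-Cantelli argument: almost surely infinitely many atoms of size
  at least \<epsilon> have a weight above 1, and each of them contributes at least
  \<epsilon>.\<close>

lemma AE_escapes: "AE \<omega> in M. escapes (Z \<omega>) {k\<in>K. x k \<le> b}"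
proof -
  obtain \<epsilon> where \<epsilon>: "\<epsilon> > 0" and inf: "infinite {k\<in>K. x k \<le> b \<and> ennreal \<epsilon> \<le> y k}"
    using left_infinite by blast
  define N where "N = {k\<in>K. x k \<le> b \<and> ennreal \<epsilon> \<le> y k}"
  have NK: "N \<subseteq> K" by (auto simp: N_def)
  have "AE \<omega> in M. \<exists>k\<in>N. m < k \<and> 1 < \<zeta> k \<omega>" for m
  proof -
    have Nm: "infinite (N \<inter> {m<..})"
    proof
      assume "finite (N \<inter> {m<..})"
      moreover have "N \<subseteq> (N \<inter> {m<..}) \<union> {..m}" by auto
      ultimately show False using inf by (auto simp: N_def dest: finite_subset)
    qed
    have [measurable]: "\<zeta> k \<in> borel_measurable M" if "k \<in> N" for k
      using that NK zeta_measurable by auto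
    let ?E = "{\<omega>\<in>space M. \<forall>k\<in>N \<inter> {m<..}. \<zeta> k \<omega> \<le> 1}"
    have E [measurable]: "?E \<in> sets M" by measurable
    \<comment> \<open>Any n of the infinitely many independent weights beyond \<open>m\<close> are
      all at most 1 with probability \<open>(1 - exp (-1)) ^ n\<close>, which tends to 0.\<close>
    have le: "prob ?E \<le> (1 - exp (-1)) ^ n" for n
    proof (cases "n = 0")
      case False
      obtain F where F: "F \<subseteq> N \<inter> {m<..}" "finite F" "card F = n"
        using infinite_arbitrarily_large[OF Nm] by blast
      with False have "F \<noteq> {}" by auto
      have "prob ?E \<le> prob (\<Inter>k\<in>F. \<zeta> k -` {..1} \<inter> space M)"
        using F \<open>F \<noteq> {}\<close> NK by (intro finite_measure_mono sets.finite_INT) (auto intro!: measurable_sets zeta_measurable)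
      also have "\<dots> = (\<Prod>k\<in>F. prob (\<zeta> k -` {..1} \<inter> space M))"
        using F \<open>F \<noteq> {}\<close> NK by (intro indep_varsD[OF indep]) auto
      also have "\<dots> = (\<Prod>k\<in>F. 1 - exp (-1))"
      proof (rule prod.cong[OF refl])
        fix k assume "k \<in> F"
        then have "k \<in> K" using F NK by auto
        have "\<zeta> k -` {..1} \<inter> space M = {\<omega>\<in>space M. \<zeta> k \<omega> \<le> 1}" by auto
        then show "prob (\<zeta> k -` {..1} \<inter> space M) = 1 - exp (-1)"
          using exponential_distributedD_le[OF expo[OF \<open>k \<in> K\<close>], of 1] by simp
      qed
      finally show ?thesis using F by simp
    qed simp
    have "(\<lambda>n. (1 - exp (-1)) ^ n) \<longlonglongrightarrow> (0::real)"
      by (rule LIMSEQ_realpow_zero) auto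
    then have "prob ?E \<le> 0"
      by (rule LIMSEQ_le_const) (use le in auto)
    then have "prob ?E = 0" by (simp add: measure_le_0_iff)
    then have "AE \<omega> in M. \<omega> \<notin> ?E"
      using E by (subst AE_iff_measurable[OF E]) (auto simp: emeasure_eq_measure)
    then show ?thesis using AE_space by eventually_elim (auto simp: not_le)
  qed
  then have "AE \<omega> in M. \<forall>m. \<exists>k\<in>N. m < k \<and> 1 < \<zeta> k \<omega>"
    by (simp add: AE_all_countable)
  then show ?thesis
  proof eventually_elim
    case (elim \<omega>)
    let ?J = "{k\<in>K. x k \<le> b}"
    have inf: "infinite {k\<in>N. 1 < \<zeta> k \<omega>}"
      using elim by (auto simp: infinite_nat_iff_unbounded)
    have "of_nat n * ennreal \<epsilon> \<le> mass (Z \<omega>) ?J" for n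
    proof -
      obtain F where F: "F \<subseteq> {k\<in>N. 1 < \<zeta> k \<omega>}" "finite F" "card F = n"
        using infinite_arbitrarily_large[OF inf] by blast
      have "of_nat n * ennreal \<epsilon> = (\<Sum>k\<in>F. ennreal \<epsilon> * 1)" using F by simp
      also have "\<dots> \<le> (\<Sum>k\<in>F. y k * ennreal (\<zeta> k \<omega>))"
        using F by (intro sum_mono mult_mono) (auto simp: N_def)
      also have "\<dots> = mass (Z \<omega>) F"
        unfolding mass_def using F NK by (subst emeasure_point_measure_finite2) auto
      also have "\<dots> \<le> mass (Z \<omega>) ?J"
        using F by (intro mass_mono) (auto simp: N_def)
      finally show ?thesis .
    qed
    then have top: "ennreal t < mass (Z \<omega>) ?J" for t
    proof -
      \<comment> \<open>The maximum covers negative t, where \<open>ennreal t\<close> is 0.\<close>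
      obtain n where n: "max t 0 < of_nat n * \<epsilon>"
        using reals_Archimedean3[OF \<epsilon>] by blast
      then have "ennreal t < ennreal (of_nat n * \<epsilon>)"
        by (intro ennreal_lessI) auto
      also have "\<dots> = of_nat n * ennreal \<epsilon>"
        using \<epsilon> by (simp add: ennreal_mult ennreal_of_nat_eq_real_of_nat)
      finally show ?thesis using \<open>of_nat n * ennreal \<epsilon> \<le> mass (Z \<omega>) ?J\<close> by (rule less_le_trans)
    qed
    show ?case
      unfolding escapes_def
    proof
      fix t :: real
      \<comment> \<open>The whole mass exceeds t; continuity from below finds a finite left end that
        suffices.\<close>
      have "(\<lambda>n. mass (Z \<omega>) {k\<in>?J. - real n < x k}) \<longlonglongrightarrow> mass (Z \<omega>) (\<Union>n. {k\<in>?J. - real n < x k})"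
        by (intro mass_tendsto_Union) (auto simp: incseq_def)
      moreover have "(\<Union>n. {k\<in>?J. - real n < x k}) = ?J"
      proof safe
        fix k assume "k \<in> K" "x k \<le> b"
        obtain n :: nat where "- x k < real n" using reals_Archimedean2 by blast
        then show "k \<in> (\<Union>n. {k\<in>?J. - real n < x k})" 
          using \<open>k \<in> K\<close> \<open>x k \<le> b\<close> by (intro UN_I[of n]) auto
      qed
      ultimately have "eventually (\<lambda>n. ennreal t < mass (Z \<omega>) {k\<in>?J. - real n < x k}) sequentially"
        using top[of t] by (auto intro: order_tendstoD)
      then show "\<exists>c. ennreal t < mass (Z \<omega>) {k\<in>?J. c < x k}"
        by (auto simp: eventually_sequentially)
    qed
  qed
qed

end

section \<open>Expectations at the hitting position\<close>

text \<open>First-order expansion valid for all s \<ge> 0: near 0 it is differentiability, and for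
  larger s boundedness of f lets a quadratic term absorb the error. The value 0 beyond t matches
  \<open>renewal\<close> with \<open>c\<close> = 0.\<close>

lemma taylor_truncated:
  fixes f :: "real \<Rightarrow> real"
  assumes bnd: "\<And>s. \<bar>f s\<bar> \<le> B" and D: "(f has_real_derivative D) (at t within {0..})"
    and t: "0 < t" and \<epsilon>: "0 < \<epsilon>"
  shows "\<exists>C\<ge>0. \<forall>s\<ge>0. \<bar>(if s \<le> t then f (t - s) else 0) - f t + s * D\<bar> \<le> \<epsilon> * s + C * s\<^sup>2"
proof -
  obtain d where d: "d > 0"
    and near: "\<And>r. r \<ge> 0 \<Longrightarrow> \<bar>r - t\<bar> < d \<Longrightarrow> \<bar>f r - f t - D * (r - t)\<bar> \<le> \<epsilon> * \<bar>r - t\<bar>"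
    using D \<epsilon> unfolding has_field_derivative_def has_derivative_within_alt by fastforce
  \<comment> \<open>Staying below t keeps the truncation inactive and t - s in the domain of the
    one-sided derivative.\<close>
  define \<delta> where "\<delta> = min d t"
  \<comment> \<open>For s \<ge> \<delta> one has 1 \<le> s/\<delta>; the two summands absorb the
    bound \<open>2 * B\<close> and the linear term respectively.\<close>
  define C where "C = 2 * B / \<delta>\<^sup>2 + \<bar>D\<bar> / \<delta>"
  have \<delta>: "\<delta> > 0" using d t by (simp add: \<delta>_def)
  have B: "0 \<le> B" using bnd[of 0] by linarith
  have C: "C \<ge> 0" using \<delta> B by (simp add: C_def)
  have "\<bar>(if s \<le> t then f (t - s) else 0) - f t + s * D\<bar> \<le> \<epsilon> * s + C * s\<^sup>2" if s: "s \<ge> 0" for s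
  proof (cases "s < \<delta>")
    case True
    then have "\<bar>f (t - s) - f t - D * (t - s - t)\<bar> \<le> \<epsilon> * \<bar>t - s - t\<bar>"
      using s by (intro near) (auto simp: \<delta>_def)
    moreover have "0 \<le> C * s\<^sup>2" using C by simp
    ultimately show ?thesis using True s by (simp add: \<delta>_def mult.commute)
  next
    case False
    have "\<bar>if s \<le> t then f (t - s) else 0\<bar> \<le> B" using bnd B by simp
    moreover have "\<bar>s * D\<bar> = \<bar>D\<bar> * s" using s by (simp add: abs_mult)
    ultimately have "\<bar>(if s \<le> t then f (t - s) else 0) - f t + s * D\<bar> \<le> 2 * B + \<bar>D\<bar> * s"
      using bnd[of t] by linarith
    also have "2 * B \<le> 2 * B / \<delta>\<^sup>2 * s\<^sup>2"
    proof -
      have "1 \<le> (s / \<delta>)\<^sup>2" using False \<delta> by (intro one_le_power) (simp add: field_simps)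
      then show ?thesis using B mult_left_mono[of 1 "(s / \<delta>)\<^sup>2" "2 * B"] by (simp add: power_divide)
    qed
    also have "\<bar>D\<bar> * s \<le> \<bar>D\<bar> / \<delta> * s\<^sup>2"
    proof -
      have "s \<le> s * (s / \<delta>)" using False \<delta> s mult_left_mono[of 1 "s / \<delta>" s] by (simp add: field_simps)
      then show ?thesis using mult_left_mono[of s "s * (s / \<delta>)" "\<bar>D\<bar>"] by (simp add: power2_eq_square)
    qed
    finally have "\<bar>(if s \<le> t then f (t - s) else 0) - f t + s * D\<bar> \<le> C * s\<^sup>2"
      by (simp add: C_def algebra_simps)
    moreover have "0 \<le> \<epsilon> * s" using \<epsilon> s by simp
    ultimately show ?thesis by linarith
  qed
  with C show ?thesis by blast
qed

section \<open>Expectations of the test function as functions of the level\<close>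

locale exp_family_test = exp_family K x y M \<zeta>
  for K x y and M :: "'a measure" and \<zeta> +
  fixes u :: "real \<Rightarrow> real" and B :: real
  assumes u_cont: "continuous_on UNIV u" and u_bnd: "\<And>a. \<bar>u a\<bar> \<le> B"
begin

text \<open>With indices x k \<le> a this is \<open>u_W\<close> at a; with indices x k < a it is the
  function v of the introductory overview.\<close>

definition U :: "nat set \<Rightarrow> real \<Rightarrow> real" where
  "U J t = (\<integral>\<omega>. u (hit (Z \<omega>) J t) \<partial>M)"

lemma u_measurable [measurable]: "u \<in> borel_measurable borel"
  using u_cont by (rule borel_measurable_continuous_onI)

lemma u_hit_measurable:
  assumes "J \<subseteq> K" "\<And>k. k \<in> J \<Longrightarrow> x k \<le> b"
  shows "(\<lambda>(t, \<xi>). u (hit \<xi> J t)) \<in> borel_measurable (borel \<Otimes>\<^sub>M PiM J (\<lambda>_. borel))"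
  using measurable_compose[OF hit_measurable[OF assms] u_measurable] by (simp add: case_prod_beta)

lemma u_hit_pair_rv:
  assumes "J \<subseteq> K" "\<And>k. k \<in> J \<Longrightarrow> x k \<le> b"
  shows "(\<lambda>(t, \<omega>). u (hit (Z \<omega>) J t)) \<in> borel_measurable (borel \<Otimes>\<^sub>M M)"
proof -
  have "(\<lambda>p. (fst p, restrict (Z (snd p)) J)) \<in> measurable (borel \<Otimes>\<^sub>M M) (borel \<Otimes>\<^sub>M PiM J (\<lambda>_. borel))"
    by (intro measurable_Pair measurable_fst measurable_compose[OF measurable_snd restrict_measurable[OF assms(1)]])
  from measurable_compose[OF this u_hit_measurable[OF assms]] show ?thesis
    by (simp add: case_prod_beta hit_restrict[OF assms(1)])
qed

lemma u_hit_rv: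
  assumes "J \<subseteq> K" "\<And>k. k \<in> J \<Longrightarrow> x k \<le> b"
  shows "(\<lambda>\<omega>. u (hit (Z \<omega>) J t)) \<in> borel_measurable M"
  using measurable_compose[OF measurable_Pair1' u_hit_pair_rv[OF assms], of t] by simp

lemma U_measurable:
  assumes "J \<subseteq> K" "\<And>k. k \<in> J \<Longrightarrow> x k \<le> b"
  shows "U J \<in> borel_measurable borel"
  unfolding U_def[abs_def] by (rule borel_measurable_lebesgue_integral) (rule u_hit_pair_rv[OF assms])

lemma B_nonneg: "0 \<le> B"
  using u_bnd[of 0] by linarith

lemma U_bnd: "\<bar>U J t\<bar> \<le> B"
proof (cases "integrable M (\<lambda>\<omega>. u (hit (Z \<omega>) J t))")
  case True
  have "\<bar>U J t\<bar> \<le> (\<integral>\<omega>. \<bar>u (hit (Z \<omega>) J t)\<bar> \<partial>M)"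
    unfolding U_def by (rule integral_abs_bound)
  also have "\<dots> \<le> (\<integral>\<omega>. B \<partial>M)"
    using True u_bnd by (intro integral_mono) auto
  finally show ?thesis by (simp add: prob_space)
qed (simp add: U_def not_integrable_integral_eq B_nonneg)

text \<open>\<open>hit_shift\<close> in expectation: given the mass of \<open>C\<close>, the
  remainder is an independent process on \<open>J\<close> at the reduced level. \<open>c\<close> is
  the value on the event that \<open>C\<close> is not crossed; it is chosen as \<open>u a\<close>
  for a single atom and as 0 for the right quotient.\<close>

lemma renewal:
  assumes JC: "J \<subseteq> K" "C \<subseteq> K" and above: "\<And>j k. j \<in> J \<Longrightarrow> k \<in> C \<Longrightarrow> x j < x k"
    and b: "\<And>k. k \<in> J \<Longrightarrow> x k \<le> b" and t: "0 \<le> t"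
  shows "(\<integral>\<omega>. (if mass (Z \<omega>) C \<le> ennreal t then u (hit (Z \<omega>) (J \<union> C) t) else c) \<partial>M) =
    (\<integral>\<omega>. (if mass (Z \<omega>) C \<le> ennreal t then U J (t - enn2real (mass (Z \<omega>) C)) else c) \<partial>M)"
proof -
  define g :: "ennreal \<times> (nat \<Rightarrow> real) \<Rightarrow> real" where
    "g = (\<lambda>p. if fst p \<le> ennreal t then u (hit (snd p) J (t - enn2real (fst p))) else c)"
  have "(\<lambda>p. (t - enn2real (fst p), snd p)) \<in>
      measurable (borel \<Otimes>\<^sub>M PiM J (\<lambda>_. borel)) (borel \<Otimes>\<^sub>M PiM J (\<lambda>_. borel))"
    by measurable
  from measurable_compose[OF this u_hit_measurable[OF JC(1) b]]
  have [measurable]: "(\<lambda>p. u (hit (snd p) J (t - enn2real (fst p)))) \<in>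
      borel_measurable (borel \<Otimes>\<^sub>M PiM J (\<lambda>_. borel))"
    by simp
  have g: "g \<in> borel_measurable (borel \<Otimes>\<^sub>M PiM J (\<lambda>_. borel))"
    unfolding g_def by measurable
  have bnd: "\<bar>g p\<bar> \<le> max B \<bar>c\<bar>" for p
    using u_bnd by (simp add: g_def le_max_iff_disj)
  have dis: "J \<inter> C = {}" using above by force
  have "(\<integral>\<omega>. (if mass (Z \<omega>) C \<le> ennreal t then u (hit (Z \<omega>) (J \<union> C) t) else c) \<partial>M) =
      (\<integral>\<omega>. g (mass (Z \<omega>) C, restrict (Z \<omega>) J) \<partial>M)"
    using JC above t by (intro Bochner_Integration.integral_cong) (auto simp: g_def hit_shift hit_restrict)
  also have "\<dots> = (\<integral>\<omega>. (\<integral>\<omega>'. g (mass (Z \<omega>) C, restrict (Z \<omega>') J) \<partial>M) \<partial>M)"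
    by (rule integral_mass_restrict_iterated[OF JC dis g bnd])
  also have "\<dots> = (\<integral>\<omega>. (if mass (Z \<omega>) C \<le> ennreal t then U J (t - enn2real (mass (Z \<omega>) C)) else c) \<partial>M)"
    using JC by (intro Bochner_Integration.integral_cong) (auto simp: g_def U_def hit_restrict prob_space)
  finally show ?thesis .
qed

lemma U_tendsto:
  assumes J: "\<And>n. J n \<subseteq> K" "\<And>n k. k \<in> J n \<Longrightarrow> x k \<le> b"
    and J': "J' \<subseteq> K" "\<And>k. k \<in> J' \<Longrightarrow> x k \<le> b"
    and lim: "AE \<omega> in M. (\<lambda>n. hit (Z \<omega>) (J n) (s n)) \<longlonglongrightarrow> hit (Z \<omega>) J' t"
  shows "(\<lambda>n. U (J n) (s n)) \<longlonglongrightarrow> U J' t"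
  unfolding U_def
proof (rule integral_dominated_convergence)
  show "AE \<omega> in M. (\<lambda>n. u (hit (Z \<omega>) (J n) (s n))) \<longlonglongrightarrow> u (hit (Z \<omega>) J' t)"
    using lim by eventually_elim (auto intro: continuous_on_tendsto_compose[OF u_cont])
  show "integrable M (\<lambda>_. B)" by simp
qed (use u_hit_rv[OF J] u_hit_rv[OF J'] u_bnd in auto)

lemma AE_escapes_less: "AE \<omega> in M. escapes (Z \<omega>) {k\<in>K. x k < a}"
  using AE_escapes[of "a - 1"] by eventually_elim (auto elim: escapes_mono)

text \<open>For a fixed limit t, only rational points \<open>q\<close> have to avoid the level, so
  countably many null events from \<open>AE_mass_neq\<close> are discarded before passing to the
  limit.\<close>

lemma U_continuous: "continuous_on {0..} (U {k\<in>K. x k < a})"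
  unfolding continuous_on_sequentially comp_def
proof (intro allI ballI impI)
  fix s :: "nat \<Rightarrow> real" and t :: real
  assume t: "t \<in> {0..}" and st: "(\<forall>n. s n \<in> {0..}) \<and> s \<longlonglongrightarrow> t"
  then have s: "s \<longlonglongrightarrow> t" "\<And>n. 0 \<le> s n" "0 \<le> t" by auto
  let ?J = "{k\<in>K. x k < a}"
  have "AE \<omega> in M. \<forall>q\<in>\<rat>. t > 0 \<longrightarrow> mass (Z \<omega>) {k\<in>?J. q < x k} \<noteq> ennreal t"
    by (subst AE_ball_countable) (auto simp: countable_rat intro!: AE_mass_neq)
  then have "AE \<omega> in M. (\<lambda>n. hit (Z \<omega>) ?J (s n)) \<longlonglongrightarrow> hit (Z \<omega>) ?J t"
    using AE_escapes_less[of a]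
  proof eventually_elim
    case (elim \<omega>)
    then show ?case using s by (intro hit_tendsto_time[of _ a]) auto
  qed
  then show "(\<lambda>n. U ?J (s n)) \<longlonglongrightarrow> U ?J t"
    by (intro U_tendsto[of _ a]) auto
qed

section \<open>Weights of short intervals and the right quotient\<close>

lemma wt_finite:
  assumes "X \<subseteq> {k\<in>K. p < x k \<and> x k \<le> q}"
  shows "wt X < \<infinity>"
proof -
  have "wt X \<le> wt {k\<in>K. p < x k \<and> x k \<le> q}"
    using assms by (intro emeasure_mono) (auto simp: sets_point_measure)
  then show ?thesis using locally_finite by (rule le_less_trans)
qed

lemma wt_tendsto_Inter:
  assumes "decseq X" "X 0 \<subseteq> {k\<in>K. p < x k \<and> x k \<le> q}"
  shows "(\<lambda>n. enn2real (wt (X n))) \<longlonglongrightarrow> enn2real (wt (\<Inter>n. X n))"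
proof -
  have sub: "X n \<subseteq> {k\<in>K. p < x k \<and> x k \<le> q}" for n
    using assms decseqD[OF assms(1), of 0 n] by blast
  have "(\<lambda>n. wt (X n)) \<longlonglongrightarrow> wt (\<Inter>n. X n)"
    using assms(1) sub less_imp_neq[OF wt_finite[OF sub]]
    by (intro Lim_emeasure_decseq) (auto simp: sets_point_measure)
  moreover have "(\<Inter>n. X n) \<subseteq> {k\<in>K. p < x k \<and> x k \<le> q}" using sub by blast
  from wt_finite[OF this] have "ennreal (enn2real (wt (\<Inter>n. X n))) = wt (\<Inter>n. X n)" by simp
  ultimately show ?thesis by (intro tendsto_enn2real) auto
qed

lemma wt_right_tendsto:
  "((\<lambda>h. enn2real (wt {k\<in>K. a < x k \<and> x k \<le> a + h})) \<longlongrightarrow> 0) (at_right 0)"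
proof (rule tendsto_at_right_sequentially[of 0 1])
  fix S :: "nat \<Rightarrow> real" assume S: "\<And>n. 0 < S n" "decseq S" "S \<longlonglongrightarrow> 0"
  let ?X = "\<lambda>n. {k\<in>K. a < x k \<and> x k \<le> a + S n}"
  have "(\<lambda>n. enn2real (wt (?X n))) \<longlonglongrightarrow> enn2real (wt (\<Inter>n. ?X n))"
  proof (intro wt_tendsto_Inter[of _ a "a + S 0"] decseq_SucI)
    fix n show "?X (Suc n) \<subseteq> ?X n" using decseq_SucD[OF S(2), of n] by auto
  qed simp
  also have "(\<Inter>n. ?X n) = {}"
  proof -
    have False if "\<forall>n. a < x k \<and> x k \<le> a + S n" for k
    proof -
      have "eventually (\<lambda>n. S n < x k - a) sequentially"
        using that S(3) by (intro order_tendstoD) auto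
      then obtain n where "S n < x k - a" by (auto simp: eventually_sequentially)
      with that show False by (auto dest: spec[of _ n])
    qed
    then show ?thesis by auto
  qed
  finally show "(\<lambda>n. enn2real (wt (?X n))) \<longlonglongrightarrow> 0" by simp
qed simp

text \<open>Integrates the Taylor inequality against the law of the mass S of \<open>C\<close>,
  using that S has mean \<sigma> and second moment at most twice the square of \<sigma>. The event S
  > t costs the additional term with \<open>B\<close>.\<close>

lemma increment_bound:
  assumes JC: "J \<subseteq> K" "C \<subseteq> K" and above: "\<And>j k. j \<in> J \<Longrightarrow> k \<in> C \<Longrightarrow> x j < x k"
    and b: "\<And>k. k \<in> J \<Longrightarrow> x k \<le> b" "\<And>k. k \<in> C \<Longrightarrow> x k \<le> b"
    and fin: "wt C < \<infinity>" and t: "0 < t" and c: "0 \<le> c"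
    and taylor: "\<And>s. 0 \<le> s \<Longrightarrow>
      \<bar>(if s \<le> t then U J (t - s) else 0) - U J t + s * D\<bar> \<le> \<epsilon> * s + c * s\<^sup>2"
  defines "\<sigma> \<equiv> enn2real (wt C)"
  shows "\<bar>U (J \<union> C) t - U J t + \<sigma> * D\<bar> \<le> \<epsilon> * \<sigma> + 2 * (c + B / t\<^sup>2) * \<sigma>\<^sup>2"
proof -
  define S where "S \<omega> = enn2real (mass (Z \<omega>) C)" for \<omega>
  define Y where "Y \<omega> = u (hit (Z \<omega>) (J \<union> C) t)" for \<omega>
  \<comment> \<open>Cut off where \<open>C\<close> is not crossed, since the renewal identity
    applies only where its mass is at most t.\<close>
  define Y' where "Y' \<omega> = (if mass (Z \<omega>) C \<le> ennreal t then Y \<omega> else 0)" for \<omega>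
  define T where "T \<omega> = (if mass (Z \<omega>) C \<le> ennreal t then U J (t - S \<omega>) else 0)" for \<omega>
  have [measurable]: "(\<lambda>\<omega>. mass (Z \<omega>) C) \<in> borel_measurable M" using JC by (intro mass_rv)
  have [measurable]: "S \<in> borel_measurable M" unfolding S_def[abs_def] by measurable
  have [measurable]: "Y \<in> borel_measurable M"
    unfolding Y_def[abs_def] using JC b by (intro u_hit_rv[of _ b]) auto
  have [measurable]: "Y' \<in> borel_measurable M" unfolding Y'_def[abs_def] by measurable
  have [measurable]: "U J \<in> borel_measurable borel" using JC b by (intro U_measurable[of _ b]) auto
  have [measurable]: "T \<in> borel_measurable M" unfolding T_def[abs_def] by measurable
  have iY: "integrable M Y" and iY': "integrable M Y'" and iT: "integrable M T"
    using u_bnd U_bnd B_nonneg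
    by (auto intro!: integrable_const_bound[of _ B] simp: Y_def Y'_def T_def)
  have massS: "AE \<omega> in M. mass (Z \<omega>) C = ennreal (S \<omega>)"
    using AE_mass_finite[OF JC(2) fin] by eventually_elim (simp add: S_def)
  have wtC: "wt C = ennreal \<sigma>" using fin by (simp add: \<sigma>_def)
  have \<sigma>0: "0 \<le> \<sigma>" by (simp add: \<sigma>_def)
  have S0: "0 \<le> S \<omega>" for \<omega> by (simp add: S_def)
  have "(\<integral>\<^sup>+\<omega>. ennreal (S \<omega>) \<partial>M) = (\<integral>\<^sup>+\<omega>. mass (Z \<omega>) C \<partial>M)"
    using massS by (intro nn_integral_cong_AE) auto
  also have "\<dots> = ennreal \<sigma>" by (simp add: nn_integral_mass_zeta[OF JC(2)] wtC)
  finally have "has_bochner_integral M S \<sigma>"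
    using S0 by (intro has_bochner_integral_nn_integral) (auto simp: \<sigma>_def)
  then have iS: "integrable M S" and S: "(\<integral>\<omega>. S \<omega> \<partial>M) = \<sigma>"
    by (auto simp: has_bochner_integral_iff)
  have "(\<integral>\<^sup>+\<omega>. ennreal ((S \<omega>)\<^sup>2) \<partial>M) = (\<integral>\<^sup>+\<omega>. (mass (Z \<omega>) C)\<^sup>2 \<partial>M)"
    using massS S0 by (intro nn_integral_cong_AE) (auto simp: ennreal_power)
  also have "\<dots> \<le> 2 * (wt C)\<^sup>2" by (rule nn_integral_mass_zeta_square[OF JC(2)])
  also have "\<dots> = ennreal (2 * \<sigma>\<^sup>2)" using \<sigma>0 by (simp add: wtC ennreal_power ennreal_mult)
  finally have S2: "(\<integral>\<^sup>+\<omega>. ennreal ((S \<omega>)\<^sup>2) \<partial>M) \<le> ennreal (2 * \<sigma>\<^sup>2)" .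
  have iS2: "integrable M (\<lambda>\<omega>. (S \<omega>)\<^sup>2)"
    using le_less_trans[OF S2 ennreal_less_top] by (intro integrableI_nonneg) auto
  have S2: "(\<integral>\<omega>. (S \<omega>)\<^sup>2 \<partial>M) \<le> 2 * \<sigma>\<^sup>2"
    using S2 by (intro integral_real_bounded) auto
  have "U (J \<union> C) t = (\<integral>\<omega>. Y \<omega> \<partial>M)" by (simp add: U_def Y_def)
  then have "\<bar>U (J \<union> C) t - (\<integral>\<omega>. Y' \<omega> \<partial>M)\<bar> = \<bar>\<integral>\<omega>. Y \<omega> - Y' \<omega> \<partial>M\<bar>"
    using iY iY' by simp
  also have "\<dots> \<le> (\<integral>\<omega>. \<bar>Y \<omega> - Y' \<omega>\<bar> \<partial>M)" by (rule integral_abs_bound)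
  also have "\<dots> \<le> (\<integral>\<omega>. B / t\<^sup>2 * (S \<omega>)\<^sup>2 \<partial>M)"
  proof (intro integral_mono_AE)
    \<comment> \<open>Chebyshev's argument: the difference vanishes if S \<le> t, and otherwise S/t
      exceeds 1.\<close>
    show "AE \<omega> in M. \<bar>Y \<omega> - Y' \<omega>\<bar> \<le> B / t\<^sup>2 * (S \<omega>)\<^sup>2"
      using massS
    proof eventually_elim
      case (elim \<omega>)
      show ?case
      proof (cases "S \<omega> \<le> t")
        case True
        then show ?thesis using elim B_nonneg t by (simp add: Y'_def ennreal_leI)
      next
        case False
        then have "t\<^sup>2 \<le> (S \<omega>)\<^sup>2" using t by (intro power_mono) auto
        then have "B \<le> B / t\<^sup>2 * (S \<omega>)\<^sup>2"
          using mult_left_mono[of "t\<^sup>2" "(S \<omega>)\<^sup>2" B] B_nonneg t by (simp add: field_simps)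
        moreover have "\<bar>Y \<omega>\<bar> \<le> B" by (simp add: Y_def u_bnd)
        moreover have "Y' \<omega> = 0" using False elim t S0[of \<omega>] by (simp add: Y'_def)
        ultimately show ?thesis by simp
      qed
    qed
  qed (use iY iY' iS2 in auto)
  also have "\<dots> \<le> B / t\<^sup>2 * (2 * \<sigma>\<^sup>2)"
    using S2 B_nonneg t iS2 by (simp add: divide_right_mono mult_left_mono)
  finally have 1: "\<bar>U (J \<union> C) t - (\<integral>\<omega>. Y' \<omega> \<partial>M)\<bar> \<le> B / t\<^sup>2 * (2 * \<sigma>\<^sup>2)" .
  have "(\<integral>\<omega>. Y' \<omega> \<partial>M) = (\<integral>\<omega>. T \<omega> \<partial>M)"
    unfolding Y'_def Y_def T_def S_def using t by (intro renewal[OF JC above b(1)]) auto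
  then have "\<bar>(\<integral>\<omega>. Y' \<omega> \<partial>M) - U J t + \<sigma> * D\<bar> = \<bar>\<integral>\<omega>. T \<omega> - U J t + S \<omega> * D \<partial>M\<bar>"
    using iT iS by (simp add: S prob_space)
  also have "\<dots> \<le> (\<integral>\<omega>. \<bar>T \<omega> - U J t + S \<omega> * D\<bar> \<partial>M)" by (rule integral_abs_bound)
  also have "\<dots> \<le> (\<integral>\<omega>. \<epsilon> * S \<omega> + c * (S \<omega>)\<^sup>2 \<partial>M)"
  proof (intro integral_mono_AE)
    show "AE \<omega> in M. \<bar>T \<omega> - U J t + S \<omega> * D\<bar> \<le> \<epsilon> * S \<omega> + c * (S \<omega>)\<^sup>2"
      using massS
    proof eventually_elim
      case (elim \<omega>)
      then show ?case using taylor[OF S0[of \<omega>]] t by (simp add: T_def)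
    qed
  qed (use iT iS iS2 in auto)
  also have "\<dots> \<le> \<epsilon> * \<sigma> + c * (2 * \<sigma>\<^sup>2)"
    using S2 c iS iS2 by (simp add: S mult_left_mono)
  finally show ?thesis using 1 by (simp add: algebra_simps)
qed

text \<open>Dividing \<open>increment_bound\<close> by \<sigma> leaves half of \<open>e\<close> plus
  a constant multiple of \<sigma>, and \<sigma> tends to 0. The assumption \<open>pos\<close> keeps
  the denominators nonzero; density of the jump set provides it.\<close>

lemma right_quotient_tendsto:
  fixes a :: real
  defines "J \<equiv> {k\<in>K. x k \<le> a}" and "C \<equiv> \<lambda>h. {k\<in>K. a < x k \<and> x k \<le> a + h}"
  assumes D: "(U J has_real_derivative D) (at t within {0..})" and t: "0 < t"
    and pos: "\<And>h. 0 < h \<Longrightarrow> 0 < wt (C h)"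
  shows "((\<lambda>h. (U {k\<in>K. x k \<le> a + h} t - U J t) / enn2real (wt (C h))) \<longlongrightarrow> - D) (at_right 0)"
proof (rule tendstoI)
  fix e :: real assume e: "0 < e"
  obtain c where c: "c \<ge> 0" and taylor: "\<And>s. s \<ge> 0 \<Longrightarrow>
      \<bar>(if s \<le> t then U J (t - s) else 0) - U J t + s * D\<bar> \<le> e / 2 * s + c * s\<^sup>2"
    using taylor_truncated[OF U_bnd D t, of "e / 2"] e by auto
  have "((\<lambda>h. 2 * (c + B / t\<^sup>2) * enn2real (wt (C h))) \<longlongrightarrow> 2 * (c + B / t\<^sup>2) * 0) (at_right 0)"
    unfolding C_def by (intro tendsto_mult tendsto_const wt_right_tendsto)
  then have "eventually (\<lambda>h. 2 * (c + B / t\<^sup>2) * enn2real (wt (C h)) < e / 2) (at_right 0)"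
    using e by (intro order_tendstoD) auto
  moreover have "eventually (\<lambda>h::real. 0 < h) (at_right 0)" by (rule eventually_at_right_less)
  ultimately show "eventually (\<lambda>h. dist ((U {k\<in>K. x k \<le> a + h} t - U J t) / enn2real (wt (C h))) (- D) < e) (at_right 0)"
  proof eventually_elim
    case (elim h)
    let ?\<sigma> = "enn2real (wt (C h))"
    have fin: "wt (C h) < \<infinity>" by (rule wt_finite[of _ a "a + h"]) (simp add: C_def)
    then have \<sigma>: "0 < ?\<sigma>" using pos[of h] elim by (simp add: enn2real_positive_iff)
    have eq: "{k\<in>K. x k \<le> a + h} = J \<union> C h" using elim by (auto simp: J_def C_def)
    have "\<bar>U (J \<union> C h) t - U J t + ?\<sigma> * D\<bar> \<le> e / 2 * ?\<sigma> + 2 * (c + B / t\<^sup>2) * ?\<sigma>\<^sup>2"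
      using elim(2) by (intro increment_bound[of _ _ "a + h"] fin t c taylor) (auto simp: J_def C_def)
    also have "\<dots> = (e / 2 + 2 * (c + B / t\<^sup>2) * ?\<sigma>) * ?\<sigma>"
      by (simp add: power2_eq_square algebra_simps)
    also have "\<dots> < e * ?\<sigma>"
      using elim(1) \<sigma> by (intro mult_strict_right_mono) auto
    finally have "\<bar>U (J \<union> C h) t - U J t + ?\<sigma> * D\<bar> / ?\<sigma> < e"
      using \<sigma> by (simp add: divide_less_eq)
    also have "\<bar>U (J \<union> C h) t - U J t + ?\<sigma> * D\<bar> / ?\<sigma> = \<bar>(U (J \<union> C h) t - U J t + ?\<sigma> * D) / ?\<sigma>\<bar>"
      using \<sigma> by simp
    also have "(U (J \<union> C h) t - U J t + ?\<sigma> * D) / ?\<sigma> = (U (J \<union> C h) t - U J t) / ?\<sigma> + D"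
      using \<sigma> by (simp add: add_divide_distrib)
    finally show ?case by (simp add: eq dist_real_def)
  qed
qed

section \<open>Left quotient and time derivative at a jump point\<close>

context
  fixes i :: nat and a :: real
  assumes i: "i \<in> K" and a: "a = x i"
begin

abbreviation Jm where "Jm \<equiv> {k\<in>K. x k < a}"
abbreviation Ja where "Ja \<equiv> {k\<in>K. x k \<le> a}"

definition yi :: real where "yi = enn2real (y i)"

lemma yi: "y i = ennreal yi" "0 < yi"
  using y_pos[OF i] y_fin[OF i] by (auto simp: yi_def enn2real_positive_iff less_top)

lemma Ja_eq: "Ja = Jm \<union> {i}"
proof -
  have "x k \<noteq> a" if "k \<in> K" "k \<noteq> i" for k
    using that inj_onD[OF inj_x, of k i] i a by auto
  then show ?thesis using i a by (auto simp: less_le)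
qed

text \<open>The half-open intervals shrink to the point a, which carries the single atom
  \<open>i\<close>; finiteness of the weights permits continuity from above.\<close>

lemma wt_left_tendsto:
  "((\<lambda>h. enn2real (wt {k\<in>K. a - h < x k \<and> x k \<le> a})) \<longlongrightarrow> yi) (at_right 0)"
proof (rule tendsto_at_right_sequentially[of 0 1])
  fix S :: "nat \<Rightarrow> real" assume S: "\<And>n. 0 < S n" "decseq S" "S \<longlonglongrightarrow> 0"
  let ?X = "\<lambda>n. {k\<in>K. a - S n < x k \<and> x k \<le> a}"
  have "(\<lambda>n. enn2real (wt (?X n))) \<longlonglongrightarrow> enn2real (wt (\<Inter>n. ?X n))"
  proof (intro wt_tendsto_Inter[of _ "a - S 0" a] decseq_SucI)
    fix n show "?X (Suc n) \<subseteq> ?X n" using decseq_SucD[OF S(2), of n] by auto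
  qed simp
  also have "(\<Inter>n. ?X n) = {i}"
  proof -
    have "k = i" if "\<forall>n. k \<in> K \<and> a - S n < x k \<and> x k \<le> a" for k
    proof (rule ccontr)
      assume "k \<noteq> i"
      then have "x k < a" using that inj_x i a by (force simp: inj_on_def)
      then have "eventually (\<lambda>n. S n < a - x k) sequentially"
        using S(3) by (intro order_tendstoD) auto
      then obtain n where "S n < a - x k" by (auto simp: eventually_sequentially)
      with that show False by (auto dest: spec[of _ n])
    qed
    then show ?thesis using i a S(1) by auto
  qed
  also have "wt {i} = y i"
    using i by (subst emeasure_point_measure_finite2) auto
  finally show "(\<lambda>n. enn2real (wt (?X n))) \<longlonglongrightarrow> yi" by (simp add: yi_def)
qed simp

lemma U_left_tendsto: "((\<lambda>h. U {k\<in>K. x k \<le> a - h} t) \<longlongrightarrow> U Jm t) (at_right 0)"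
proof (rule tendsto_at_right_sequentially[of 0 1])
  fix S :: "nat \<Rightarrow> real" assume S: "\<And>n. 0 < S n" "decseq S" "S \<longlonglongrightarrow> 0"
  let ?J = "\<lambda>n. {k\<in>K. x k \<le> a - S n}"
  have *: "(\<Union>n. ?J n) = Jm"
  proof safe
    fix k n assume "x k \<le> a - S n"
    then show "x k < a" using S(1)[of n] by simp
  next
    fix k assume k: "k \<in> K" "x k < a"
    then have "eventually (\<lambda>n. S n < a - x k) sequentially"
      using S(3) by (intro order_tendstoD) auto
    then obtain n where "S n < a - x k" by (auto simp: eventually_sequentially)
    with k show "k \<in> (\<Union>n. ?J n)" by (intro UN_I[of n]) auto
  qed
  have b: "x k \<le> a" if "k \<in> ?J n" for k n
    using that S(1)[of n] by simp
  have inc: "incseq ?J"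
    using S(2) by (force simp: incseq_def decseq_def)
  have "AE \<omega> in M. (\<lambda>n. hit (Z \<omega>) (?J n) t) \<longlonglongrightarrow> hit (Z \<omega>) Jm t"
    using AE_escapes[of "a - S 0"]
  proof eventually_elim
    case (elim \<omega>)
    show ?case
      unfolding *[symmetric] using inc b elim by (intro hit_tendsto_Union[of _ a]) auto
  qed
  then show "(\<lambda>n. U (?J n) t) \<longlonglongrightarrow> U Jm t"
    using b by (intro U_tendsto[of _ a]) auto
qed simp

text \<open>Numerator and denominator converge separately, the latter to the positive weight
  \<open>yi\<close>. The limit is the negative of the derivative in
  \<open>U_has_derivative\<close>.\<close>

lemma left_quotient_tendsto:
  "((\<lambda>h. (U Ja t - U {k\<in>K. x k \<le> a - h} t) / enn2real (wt {k\<in>K. a - h < x k \<and> x k \<le> a}))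
    \<longlongrightarrow> (U Ja t - U Jm t) / yi) (at_right 0)"
  using yi by (intro tendsto_divide tendsto_diff tendsto_const U_left_tendsto wt_left_tendsto) auto

text \<open>Conditioning on the atom at a: either it exceeds t and the process stays at a, with
  probability \<open>exp (- t / yi)\<close>, or a level r = t - yi * z remains for the process
  strictly left of a. Substituting r for z gives the integral.\<close>

lemma U_Ja_eq:
  assumes t: "0 \<le> t"
  shows "U Ja t = exp (- t / yi) * (u a + integral {0..t} (\<lambda>r. U Jm r * exp (r / yi)) / yi)"
proof -
  have mi: "mass (Z \<omega>) {i} \<le> ennreal t \<longleftrightarrow> \<zeta> i \<omega> \<le> t / yi" for \<omega>
  proof (cases "0 \<le> \<zeta> i \<omega>")
    case True
    then show ?thesis
      using i yi t by (simp add: mass_singleton ennreal_mult[symmetric] field_simps)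
  next
    \<comment> \<open>A negative weight has mass 0 and lies below the nonnegative quotient, so both
      sides are true.\<close>
    case False
    then have "\<zeta> i \<omega> \<le> t / yi" using yi t by (meson divide_nonneg_pos less_imp_le not_le order.trans)
    with False show ?thesis using i by (simp add: mass_singleton ennreal_neg)
  qed
  let ?v = "\<lambda>z. if z \<le> t / yi then U Jm (t - yi * z) else 0"
  let ?w = "\<lambda>z. if z \<le> t / yi then 0 else u a"
  have [measurable]: "U Jm \<in> borel_measurable borel" by (rule U_measurable[of _ a]) auto
  have [measurable]: "\<zeta> i \<in> borel_measurable M" using i by (rule zeta_measurable)
  have "U Ja t = (\<integral>\<omega>. (if mass (Z \<omega>) {i} \<le> ennreal t then u (hit (Z \<omega>) (Jm \<union> {i}) t) else u a) \<partial>M)"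
    unfolding U_def
  proof (intro Bochner_Integration.integral_cong refl)
    fix \<omega>
    have "hit (Z \<omega>) (Jm \<union> {i}) t = a" if "\<not> mass (Z \<omega>) {i} \<le> ennreal t"
      using that i a by (subst hit_eq_top[of _ i]) (auto simp: not_le)
    then show "u (hit (Z \<omega>) Ja t) =
        (if mass (Z \<omega>) {i} \<le> ennreal t then u (hit (Z \<omega>) (Jm \<union> {i}) t) else u a)"
      by (auto simp: Ja_eq)
  qed
  also have "\<dots> = (\<integral>\<omega>. (if mass (Z \<omega>) {i} \<le> ennreal t then U Jm (t - enn2real (mass (Z \<omega>) {i})) else u a) \<partial>M)"
    using i a t by (intro renewal[of _ _ a]) auto
  also have "\<dots> = (\<integral>\<omega>. ?v (\<zeta> i \<omega>) + ?w (\<zeta> i \<omega>) \<partial>M)"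
  proof (intro integral_cong_AE)
    show "AE \<omega> in M. (if mass (Z \<omega>) {i} \<le> ennreal t then U Jm (t - enn2real (mass (Z \<omega>) {i})) else u a) =
        ?v (\<zeta> i \<omega>) + ?w (\<zeta> i \<omega>)"
      using AE_zeta_pos[OF i]
    proof eventually_elim
      case (elim \<omega>)
      then have "enn2real (mass (Z \<omega>) {i}) = yi * \<zeta> i \<omega>"
        using i yi by (simp add: mass_singleton ennreal_mult[symmetric])
      then show ?case by (simp add: mi)
    qed
    have [measurable]: "(\<lambda>\<omega>. mass (Z \<omega>) {i}) \<in> borel_measurable M" using i by (intro mass_rv) auto
    show "(\<lambda>\<omega>. if mass (Z \<omega>) {i} \<le> ennreal t then U Jm (t - enn2real (mass (Z \<omega>) {i})) else u a) \<in> borel_measurable M"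
      by measurable
    show "(\<lambda>\<omega>. ?v (\<zeta> i \<omega>) + ?w (\<zeta> i \<omega>)) \<in> borel_measurable M"
      by measurable
  qed
  also have "\<dots> = (\<integral>\<omega>. ?v (\<zeta> i \<omega>) \<partial>M) + (\<integral>\<omega>. ?w (\<zeta> i \<omega>) \<partial>M)"
    using U_bnd B_nonneg
    by (intro Bochner_Integration.integral_add integrable_const_bound[of _ B] integrable_const_bound[of _ "\<bar>u a\<bar>"])
      (auto intro!: AE_I2)
  also have "(\<integral>\<omega>. ?w (\<zeta> i \<omega>) \<partial>M) = (\<integral>\<omega>. u a * indicator {\<omega>\<in>space M. t / yi < \<zeta> i \<omega>} \<omega> \<partial>M)"
    by (intro Bochner_Integration.integral_cong) (auto simp: indicator_def)
  also have "\<dots> = u a * exp (- t / yi)"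
    using exponential_distributedD_gt[OF expo[OF i], of "t / yi"] yi t by simp
  also have "(\<integral>\<omega>. ?v (\<zeta> i \<omega>) \<partial>M) = (\<integral>z. exponential_density 1 z * ?v z \<partial>lborel)"
    by (rule distributed_integral[OF expo[OF i], symmetric]) (auto simp: exponential_density_nonneg)
  \<comment> \<open>Everything but the constant \<open>exp (- t / yi)\<close> is written as a
    function of t - yi * z, ready for the affine substitution.\<close>
  also have "\<dots> = (\<integral>z. indicator {0..t} (t + (- yi) * z) * (U Jm (t + (- yi) * z) * exp ((t + (- yi) * z) / yi)) * exp (- t / yi) \<partial>lborel)"
  proof (intro Bochner_Integration.integral_cong refl)
    fix z
    have "exp (- z) = exp ((t + (- yi) * z) / yi) * exp (- t / yi)"
      using yi by (simp add: exp_add[symmetric] field_simps)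
    then show "exponential_density 1 z * ?v z =
        indicator {0..t} (t + (- yi) * z) * (U Jm (t + (- yi) * z) * exp ((t + (- yi) * z) / yi)) * exp (- t / yi)"
      using yi by (auto simp: exponential_density_def indicator_def field_simps mult_less_0_iff zero_le_mult_iff)
  qed
  also have "\<dots> = (\<integral>z. indicator {0..t} (t + (- yi) * z) * (U Jm (t + (- yi) * z) * exp ((t + (- yi) * z) / yi)) \<partial>lborel) * exp (- t / yi)"
    by simp
  also have "(\<integral>z. indicator {0..t} (t + (- yi) * z) * (U Jm (t + (- yi) * z) * exp ((t + (- yi) * z) / yi)) \<partial>lborel) =
      (\<integral>r. indicator {0..t} r * (U Jm r * exp (r / yi)) \<partial>lborel) / yi"
    \<comment> \<open>The slope is negative; its absolute value \<open>yi\<close> gives the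
      divisor.\<close>
    using yi lborel_integral_real_affine[of "- yi" "\<lambda>r. indicator {0..t} r * (U Jm r * exp (r / yi))" t]
    by (simp add: field_simps)
  also have "(\<integral>r. indicator {0..t} r * (U Jm r * exp (r / yi)) \<partial>lborel) = integral {0..t} (\<lambda>r. U Jm r * exp (r / yi))"
  proof -
    have "continuous_on {0..t} (\<lambda>r. U Jm r * exp (r / yi))"
      using yi by (intro continuous_intros continuous_on_subset[OF U_continuous]) auto
    from set_borel_integral_eq_integral(2)[OF borel_integrable_atLeastAtMost'[OF this]]
    show ?thesis by (simp add: set_lebesgue_integral_def)
  qed
  finally show ?thesis by (simp add: algebra_simps)
qed

text \<open>Product rule and fundamental theorem of calculus applied to \<open>U_Ja_eq\<close>, the
  integrand being continuous by \<open>U_continuous\<close>.\<close>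

lemma U_has_derivative:
  assumes t: "0 \<le> t"
  shows "(U Ja has_real_derivative (U Jm t - U Ja t) / yi) (at t within {0..})"
proof -
  let ?g = "\<lambda>r. U Jm r * exp (r / yi)"
  let ?F = "\<lambda>t. exp (- t / yi) * (u a + integral {0..t} ?g / yi)"
  \<comment> \<open>The right end t + 1 keeps t away from the upper boundary, so the filter agrees
    with that of \<open>{0..}\<close>, one-sided exactly at 0.\<close>
  have "continuous_on {0..t + 1} ?g"
    using yi by (intro continuous_intros continuous_on_subset[OF U_continuous]) auto
  from integral_has_real_derivative[OF this, of t]
  have I: "((\<lambda>r. integral {0..r} ?g) has_real_derivative ?g t) (at t within {0..t + 1})"
    using t by simp
  have "at t within {0..t + 1} = at t within {0..}"
    using t by (intro at_within_nhd[of _ "{..<t + 1}"]) auto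
  with I have I: "((\<lambda>r. integral {0..r} ?g) has_real_derivative ?g t) (at t within {0..})" by simp
  have "(?F has_real_derivative
      exp (- t / yi) * (- 1 / yi) * (u a + integral {0..t} ?g / yi) + exp (- t / yi) * (?g t / yi)) (at t within {0..})"
    using yi(2) by (auto intro!: derivative_eq_intros I)
  also have "exp (- t / yi) * (- 1 / yi) * (u a + integral {0..t} ?g / yi) + exp (- t / yi) * (?g t / yi) =
      (U Jm t * (exp (- t / yi) * exp (t / yi)) - ?F t) / yi"
    by (simp add: algebra_simps diff_divide_distrib add_divide_distrib)
  also have "exp (- t / yi) * exp (t / yi) = 1"
    by (simp add: exp_add[symmetric])
  also have "?F t = U Ja t" using U_Ja_eq[OF t] by simp
  finally have "(?F has_real_derivative (U Jm t - U Ja t) / yi) (at t within {0..})" by simp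
  \<comment> \<open>The closed formula is established for nonnegative levels only, hence the
    transfer within \<open>{0..}\<close>.\<close>
  then show ?thesis
    by (rule has_field_derivative_transform_within[where d=1]) (use t U_Ja_eq in auto)
qed

end

end

section \<open>Atoms of a measure in the class \<open>\<T>\<close>\<close>

lemma rect_in_state_space:
  assumes "A \<in> sets borel" "B \<in> sets borel" "B \<subseteq> {0<..}"
  shows "A \<times> B \<in> sets state_space"
proof -
  have "A \<times> B \<in> sets borel"
    unfolding borel_prod[symmetric] using assms by (intro pair_measureI)
  moreover have "A \<times> B = (UNIV \<times> {0<..}) \<inter> (A \<times> B)" using assms by auto
  ultimately show ?thesis
    unfolding state_space_def sets_restrict_space by blast
qed

lemma enumerates_measurable:
  assumes "enumerates W K x y"
  shows "(\<lambda>k. (x k, y k)) \<in> measurable (count_space K) state_space"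
  using assms by (auto simp: enumerates_def state_space_def space_restrict_space)

lemma emeasure_enumerates:
  assumes W: "enumerates W K x y" and A: "A \<in> sets borel" "B \<in> sets borel" "B \<subseteq> {0<..}"
  shows "emeasure W (A \<times> B) = emeasure (count_space K) {k\<in>K. x k \<in> A \<and> y k \<in> B}"
proof -
  have "W = distr (count_space K) state_space (\<lambda>k. (x k, y k))"
    using W by (simp add: enumerates_def)
  then have "emeasure W (A \<times> B) = emeasure (count_space K) ((\<lambda>k. (x k, y k)) -` (A \<times> B) \<inter> space (count_space K))"
    using emeasure_distr[OF enumerates_measurable[OF W] rect_in_state_space[OF A]] by simp
  also have "(\<lambda>k. (x k, y k)) -` (A \<times> B) \<inter> space (count_space K) = {k\<in>K. x k \<in> A \<and> y k \<in> B}"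
    by auto
  finally show ?thesis .
qed

text \<open>Translates both the integrability condition in \<open>\<T>\<close> and
  \<open>sigma_W\<close> into total weights of index sets.\<close>

lemma nn_integral_enumerates:
  assumes W: "enumerates W K x y" and A: "A \<in> sets borel" "B \<in> sets borel" "B \<subseteq> {0<..}"
  shows "(\<integral>\<^sup>+p\<in>(A \<times> B). snd p \<partial>W) = emeasure (point_measure K y) {k\<in>K. x k \<in> A \<and> y k \<in> B}"
proof -
  have W': "W = distr (count_space K) state_space (\<lambda>k. (x k, y k))"
    using W by (simp add: enumerates_def)
  have [measurable]: "snd \<in> borel_measurable state_space"
    unfolding state_space_def borel_prod[symmetric] by (intro measurable_restrict_space1 measurable_snd)
  have [measurable]: "A \<times> B \<in> sets state_space" by (rule rect_in_state_space[OF A])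
  have "(\<integral>\<^sup>+p\<in>(A \<times> B). snd p \<partial>W) = (\<integral>\<^sup>+k. y k * indicator (A \<times> B) (x k, y k) \<partial>count_space K)"
    unfolding W' by (subst nn_integral_distr[OF enumerates_measurable[OF W]]) auto
  also have "\<dots> = (\<integral>\<^sup>+k. y k * indicator {k\<in>K. x k \<in> A \<and> y k \<in> B} k \<partial>count_space K)"
    by (intro nn_integral_cong) (auto simp: indicator_def)
  also have "\<dots> = emeasure (point_measure K y) {k\<in>K. x k \<in> A \<and> y k \<in> B}"
    by (simp add: point_measure_def emeasure_density)
  finally show ?thesis .
qed

section \<open>From membership in \<open>\<T>\<close> to properties of the enumeration\<close>

context
  fixes W :: "(real \<times> ennreal) measure" and K :: "nat set"
    and x :: "nat \<Rightarrow> real" and y :: "nat \<Rightarrow> ennreal"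
  assumes W: "W \<in> \<T>" and enum: "enumerates W K x y"
begin

lemma y_positive: "k \<in> K \<Longrightarrow> 0 < y k"
  using enum by (simp add: enumerates_def)

lemma y_finite:
  assumes "k \<in> K"
  shows "y k < \<infinity>"
proof -
  have "emeasure W (UNIV \<times> {\<infinity>}) = 0" using W by (simp add: \<T>_def)
  then have "emeasure (count_space K) {k\<in>K. x k \<in> UNIV \<and> y k \<in> {\<infinity>}} = 0"
    by (subst (asm) emeasure_enumerates[OF enum]) auto
  then show ?thesis using assms by (auto simp: emeasure_count_space_eq_0 less_top)
qed

text \<open>Two indices at one position would give a vertical line mass at least 2, against the
  supremum 1.\<close>

lemma x_inj: "inj_on x K"
proof (rule inj_onI, rule ccontr)
  fix j k assume jk: "j \<in> K" "k \<in> K" "x j = x k" "j \<noteq> k"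
  have "emeasure W ({x j} \<times> {0<..}) \<le> (SUP a. emeasure W ({a} \<times> {0<..}))"
    by (intro SUP_upper) auto
  also have "\<dots> = 1" using W by (simp add: \<T>_def)
  finally have le: "emeasure (count_space K) {i\<in>K. x i \<in> {x j} \<and> y i \<in> {0<..}} \<le> 1"
    by (subst (asm) emeasure_enumerates[OF enum]) auto
  have "ennreal 2 = emeasure (count_space K) {j, k}"
    using jk by (subst emeasure_count_space_finite) auto
  also have "\<dots> \<le> emeasure (count_space K) {i\<in>K. x i \<in> {x j} \<and> y i \<in> {0<..}}"
    using jk y_positive by (intro emeasure_mono) auto
  also note le
  finally have "ennreal 2 \<le> ennreal 1" by simp
  then show False by (subst (asm) ennreal_le_iff) auto
qed

text \<open>Atoms of size below 1 are controlled by the integrability condition; those of size at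
  least 1 are finitely many by the Radon property, and each has finite size.\<close>

lemma wt_locally_finite: "emeasure (point_measure K y) {k\<in>K. p < x k \<and> x k \<le> q} < \<infinity>"
proof -
  define L where "L = max \<bar>p\<bar> \<bar>q\<bar>"
  let ?S = "{k\<in>K. x k \<in> {-L..L} \<and> y k \<in> {0<..<ennreal 1}}"
  let ?F = "{k\<in>K. x k \<in> {-L..L} \<and> y k \<in> {1..}}"
  have "{k\<in>K. p < x k \<and> x k \<le> q} \<subseteq> ?S \<union> ?F"
    using y_positive by (auto simp: L_def not_le)
  then have "emeasure (point_measure K y) {k\<in>K. p < x k \<and> x k \<le> q} \<le> emeasure (point_measure K y) (?S \<union> ?F)"
    by (intro emeasure_mono) (auto simp: sets_point_measure)
  also have "\<dots> \<le> emeasure (point_measure K y) ?S + emeasure (point_measure K y) ?F"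
    by (intro emeasure_subadditive) (auto simp: sets_point_measure)
  also have "\<dots> < \<infinity>"
  proof -
    have "(\<integral>\<^sup>+p\<in>({-L..L} \<times> {0<..<ennreal 1}). snd p \<partial>W) < \<infinity>"
      using W unfolding \<T>_def mem_Collect_eq by (metis zero_less_one)
    then have S: "emeasure (point_measure K y) ?S < \<infinity>"
      by (subst (asm) nn_integral_enumerates[OF enum]) auto
    \<comment> \<open>The extended half-line is compact because \<open>ennreal\<close> contains the
      point at infinity.\<close>
    have "compact ({-L..L} \<times> {1::ennreal..})"
      by (intro compact_Times) (auto simp: compact_eq_closed)
    moreover have pos: "{1::ennreal..} \<subseteq> {0<..}"
      using less_le_trans[OF zero_less_one] by auto
    then have "{-L..L} \<times> {1::ennreal..} \<subseteq> UNIV \<times> {0<..}" by auto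
    moreover have "\<forall>C. compact C \<and> C \<subseteq> UNIV \<times> {0<..} \<longrightarrow> emeasure W C < \<infinity>"
      using W by (simp add: \<T>_def radon_point_measure_def)
    ultimately have "emeasure W ({-L..L} \<times> {1..}) < \<infinity>" by simp
    also have "emeasure W ({-L..L} \<times> {1..}) = emeasure (count_space K) ?F"
      by (intro emeasure_enumerates[OF enum] pos) auto
    finally have "finite ?F"
      by (rule contrapos_pp) (simp add: emeasure_count_space_infinite)
    then have "emeasure (point_measure K y) ?F = (\<Sum>k\<in>?F. y k)"
      by (subst emeasure_point_measure_finite2) auto
    also have "\<dots> < \<infinity>" using y_finite \<open>finite ?F\<close> by (simp add: less_top)
    finally show ?thesis using S by simp
  qed
  finally show ?thesis .
qed

lemma left_atoms_infinite: "\<exists>\<epsilon>>0. \<forall>b. infinite {k\<in>K. x k \<le> b \<and> ennreal \<epsilon> \<le> y k}"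
proof -
  obtain \<epsilon> :: real where \<epsilon>: "\<epsilon> > 0"
    and inf: "\<And>L. emeasure W ({..-L} \<times> {ennreal \<epsilon>..<\<infinity>}) = \<infinity>"
    using W unfolding \<T>_def by blast
  have "infinite {k\<in>K. x k \<le> b \<and> ennreal \<epsilon> \<le> y k}" for b
  proof
    assume fin: "finite {k\<in>K. x k \<le> b \<and> ennreal \<epsilon> \<le> y k}"
    have sub: "{k\<in>K. x k \<in> {..b} \<and> y k \<in> {ennreal \<epsilon>..<\<infinity>}} \<subseteq> {k\<in>K. x k \<le> b \<and> ennreal \<epsilon> \<le> y k}" by auto
    have "emeasure W ({..b} \<times> {ennreal \<epsilon>..<\<infinity>}) = emeasure (count_space K) {k\<in>K. x k \<in> {..b} \<and> y k \<in> {ennreal \<epsilon>..<\<infinity>}}"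
      using less_le_trans[of 0 "ennreal \<epsilon>"] \<epsilon> by (intro emeasure_enumerates[OF enum]) auto
    also have "\<dots> < \<infinity>"
      using finite_subset[OF sub fin] by (subst emeasure_count_space_finite) (auto simp: of_nat_less_top)
    finally show False using inf[of "- b"] by simp
  qed
  then show ?thesis using \<epsilon> by blast
qed

lemma sigma_W_eq:
  assumes "A \<in> sets borel"
  shows "sigma_W W A = emeasure (point_measure K y) {k\<in>K. x k \<in> A}"
proof -
  have "sigma_W W A = emeasure (point_measure K y) {k\<in>K. x k \<in> A \<and> y k \<in> {0<..<\<infinity>}}"
    unfolding sigma_W_def using assms by (intro nn_integral_enumerates[OF enum]) auto
  also have "{k\<in>K. x k \<in> A \<and> y k \<in> {0<..<\<infinity>}} = {k\<in>K. x k \<in> A}"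
    using y_positive y_finite by auto
  finally show ?thesis .
qed

lemma jump_set_subset: "jump_set W \<subseteq> x ` K"
proof
  fix a assume "a \<in> jump_set W"
  then have "0 < emeasure W ({a} \<times> {0<..<\<infinity>})" by (simp add: jump_set_def)
  then have "0 < emeasure (count_space K) {k\<in>K. x k \<in> {a} \<and> y k \<in> {0<..<\<infinity>}}"
    by (subst (asm) emeasure_enumerates[OF enum]) auto
  then have "{k\<in>K. x k \<in> {a} \<and> y k \<in> {0<..<\<infinity>}} \<noteq> {}" by (metis emeasure_empty less_irrefl)
  then show "a \<in> x ` K" by auto
qed

lemma wt_right_positive:
  assumes "W \<in> \<T>'" "0 < h"
  shows "0 < emeasure (point_measure K y) {k\<in>K. a < x k \<and> x k \<le> a + h}"
proof -
  \<comment> \<open>A jump point at distance less than h/2 from the midpoint lies strictly between a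
    and a + h.\<close>
  have "a + h / 2 \<in> closure (jump_set W)" using assms by (simp add: \<T>'_def)
  then obtain b where b: "b \<in> jump_set W" "dist b (a + h / 2) < h / 2"
    using assms(2) unfolding closure_approachable by (meson half_gt_zero)
  then obtain k where k: "k \<in> K" "b = x k" using jump_set_subset by auto
  have "0 < y k" using k y_positive by simp
  also have "y k = emeasure (point_measure K y) {k}"
    using k by (subst emeasure_point_measure_finite2) auto
  also have "\<dots> \<le> emeasure (point_measure K y) {k\<in>K. a < x k \<and> x k \<le> a + h}"
    using k b(2) by (intro emeasure_mono) (auto simp: sets_point_measure dist_real_def abs_less_iff field_simps)
  finally show ?thesis .
qed

end

section \<open>Identification with \<open>Z_star\<close> and conclusion\<close>

lemma (in point_family) Z_star_eq:
  "Z_star K x y \<zeta> t a \<omega> = hit (\<lambda>k. \<zeta> k \<omega>) {k\<in>K. x k \<le> a} t"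
proof -
  \<comment> \<open>Pulling the interval back along \<open>x\<close> turns \<open>tau_W\<close> into
    \<open>mass\<close>; the two infima are then taken over the same set.\<close>
  have "emeasure (tau_W K x y \<zeta> \<omega>) {c<..a} = mass (\<lambda>k. \<zeta> k \<omega>) {k\<in>{k\<in>K. x k \<le> a}. c < x k}" for c
  proof -
    have "emeasure (tau_W K x y \<zeta> \<omega>) {c<..a} =
        mass (\<lambda>k. \<zeta> k \<omega>) (x -` {c<..a} \<inter> space (point_measure K (\<lambda>k. y k * ennreal (\<zeta> k \<omega>))))"
      unfolding tau_W_def mass_def by (rule emeasure_distr) (auto simp: measurable_point_measure_eq1)
    also have "x -` {c<..a} \<inter> space (point_measure K (\<lambda>k. y k * ennreal (\<zeta> k \<omega>))) = {k\<in>{k\<in>K. x k \<le> a}. c < x k}"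
      by (auto simp: space_point_measure)
    finally show ?thesis .
  qed
  then show ?thesis by (simp add: Z_star_def hit_def)
qed

lemma continuous_compact_support_bounded:
  fixes u :: "real \<Rightarrow> real"
  assumes "continuous_on UNIV u" "compact (closure {a. u a \<noteq> 0})"
  shows "\<exists>B. \<forall>a. \<bar>u a\<bar> \<le> B"
proof -
  have "compact (u ` closure {a. u a \<noteq> 0})"
    using assms by (intro compact_continuous_image) (auto intro: continuous_on_subset)
  then have "bounded (u ` closure {a. u a \<noteq> 0})" by (rule compact_imp_bounded)
  then obtain B where B: "\<forall>a\<in>closure {a. u a \<noteq> 0}. \<bar>u a\<bar> \<le> B"
    unfolding bounded_iff by auto
  have "\<bar>u a\<bar> \<le> max B 0" for a
  proof (cases "u a = 0")
    case False
    then have "a \<in> closure {a. u a \<noteq> 0}" by (intro subsetD[OF closure_subset]) simp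
    then show ?thesis using bspec[OF B] by (simp add: le_max_iff_disj)
  qed simp
  then show ?thesis by blast
qed

theorem proposition3p5:
  fixes u :: "real \<Rightarrow> real"
    and W :: "(real \<times> ennreal) measure"
    and K :: "nat set" and x :: "nat \<Rightarrow> real" and y :: "nat \<Rightarrow> ennreal"
    and M :: "'a measure" and \<zeta> :: "nat \<Rightarrow> 'a \<Rightarrow> real"
  assumes "continuous_on UNIV u" and "\<And>a. 0 \<le> u a" and "compact (closure {a. u a \<noteq> 0})"
    and "W \<in> \<T>" and "enumerates W K x y"
    and "prob_space M"
    and "prob_space.indep_vars M (\<lambda>_. borel) \<zeta> K"
    and "\<And>k. k \<in> K \<Longrightarrow> distributed M lborel (\<zeta> k) (exponential_density 1)"
  shows "\<forall>a \<in> jump_set W. \<exists>D :: real \<Rightarrow> real.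
    (\<forall>t\<ge>0.
       ((\<lambda>s. u_W M \<zeta> K x y u s a) has_real_derivative D t) (at t within {0..}) \<and>
       ((\<lambda>h. (u_W M \<zeta> K x y u t a - u_W M \<zeta> K x y u t (a - h)) /
              enn2real (sigma_W W {a - h<..a})) \<longlongrightarrow> - D t) (at_right 0)) \<and>
    (W \<in> \<T>' \<longrightarrow> (\<forall>t>0.
       ((\<lambda>h. (u_W M \<zeta> K x y u t (a + h) - u_W M \<zeta> K x y u t a) /
              enn2real (sigma_W W {a<..a + h})) \<longlongrightarrow> - D t) (at_right 0)))"
proof
  fix a assume "a \<in> jump_set W"
  then obtain i where i: "i \<in> K" "a = x i"
    using jump_set_subset[OF assms(4,5)] by auto
  obtain B where B: "\<And>a. \<bar>u a\<bar> \<le> B"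
    using continuous_compact_support_bounded[OF assms(1,3)] by blast
  interpret prob_space M by fact
  interpret exp_family_test K x y M \<zeta> u B
    using assms B x_inj[OF assms(4,5)] y_positive[OF assms(4,5)] y_finite[OF assms(4,5)]
      wt_locally_finite[OF assms(4,5)] left_atoms_infinite[OF assms(4,5)]
    by unfold_locales auto
  have uW: "u_W M \<zeta> K x y u t b = U {k\<in>K. x k \<le> b} t" for t b
    by (simp add: u_W_def U_def Z_star_eq)
  have \<sigma>W: "sigma_W W {p<..q} = wt {k\<in>K. p < x k \<and> x k \<le> q}" for p q
    by (subst sigma_W_eq[OF assms(4,5)]) auto
  \<comment> \<open>The right-hand side of the differential equation at a; one function serves the
    derivative and both limits.\<close>
  define D where "D t = (U {k\<in>K. x k < a} t - U {k\<in>K. x k \<le> a} t) / yi i" for t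
  have der: "(U {k\<in>K. x k \<le> a} has_real_derivative D t) (at t within {0..})" if "0 \<le> t" for t
    unfolding D_def by (rule U_has_derivative[OF i that])
  have left: "((\<lambda>h. (U {k\<in>K. x k \<le> a} t - U {k\<in>K. x k \<le> a - h} t) / enn2real (wt {k\<in>K. a - h < x k \<and> x k \<le> a}))
      \<longlongrightarrow> - D t) (at_right 0)" for t
    using left_quotient_tendsto[OF i, of t] by (simp add: D_def minus_divide_left)
  have right: "((\<lambda>h. (U {k\<in>K. x k \<le> a + h} t - U {k\<in>K. x k \<le> a} t) / enn2real (wt {k\<in>K. a < x k \<and> x k \<le> a + h}))
      \<longlongrightarrow> - D t) (at_right 0)" if "0 < t" "W \<in> \<T>'" for t
    using that der wt_right_positive[OF assms(4,5)] by (intro right_quotient_tendsto) auto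
  show "\<exists>D :: real \<Rightarrow> real.
    (\<forall>t\<ge>0.
       ((\<lambda>s. u_W M \<zeta> K x y u s a) has_real_derivative D t) (at t within {0..}) \<and>
       ((\<lambda>h. (u_W M \<zeta> K x y u t a - u_W M \<zeta> K x y u t (a - h)) /
              enn2real (sigma_W W {a - h<..a})) \<longlongrightarrow> - D t) (at_right 0)) \<and>
    (W \<in> \<T>' \<longrightarrow> (\<forall>t>0.
       ((\<lambda>h. (u_W M \<zeta> K x y u t (a + h) - u_W M \<zeta> K x y u t a) /
              enn2real (sigma_W W {a<..a + h})) \<longlongrightarrow> - D t) (at_right 0)))"
    unfolding uW \<sigma>W using der left right by blast
qed

end
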